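(* Let $n\ge 0$ be an integer, let $S(n)=H(T_n,-T_n)$ be the link diagram defined in the context, and put $u=-t^{-1/2}-t^{1/2}$. Then the Jones polynomial of $S(n)$ satisfies: (i) if $n$ is even, then $V_{S(n)}(t)=u$ for every choice of orientation of $S(n)$; (ii) if $n$ is odd, then for every choice of orientation of $S(n)$ one has $V_{S(n)}(t)=t^{\pm 6}u$, i.e. $V_{S(n)}(t)\in\{t^{6}u,\;t^{-6}u\}$, where which of the two signs occurs depends on the choice of orientation.
   Context: **Bracket and Jones polynomial.** The Kauffman bracket $\langle L\rangle\in\mathbb{Z}[A,A^{-1}]$ of an unoriented link diagram $L$ is determined by the following rules. A diagram consisting of $n$ disjoint simple closed curves in the plane has bracket $\delta^{n-1}$, where $\delta=-A^{2}-A^{-2}$. One has $\langle L\sqcup O\rangle=\delta\langle L\rangle$ for a disjoint simple closed curve $O$. At each crossing, $\langle L\rangle=A\langle L_A\rangle+A^{-1}\langle L_B\rangle$, where $L_A$ is the smoothing that joins the two regions swept out when the overcrossing strand is rotated counterclockwise until it meets the undercrossing strand, and $L_B$ is the other smoothing. With this convention, removing a curl with a right-handed (positive) crossing contributes a factor $-A^{3}$. For an oriented diagram $L$, the writhe $w(L)$ is the number of right-handed ($+1$) crossings minus the number of left-handed ($-1$) crossings. A crossing is right-handed if, facing along the oriented overpass, the underpass goes from right to left. Put $X_L=(-A)^{-3w(L)}\langle L\rangle$. The Jones polynomial $V_L(t)$ is obtained from $X_L$ by the substitution $A=t^{-1/4}$. **Tangles.** A tangle is a part of a link diagram inside a disc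 whose boundary circle is crossed exactly four times, at the points NW, NE, SW, SE. Tangle diagrams are considered up to regular isotopy, i.e. planar isotopy and Reidemeister moves II and III. - The tangle $0$ consists of two disjoint uncrossed arcs joining NW to NE and SW to SE. The tangle $\infty$ consists of two disjoint uncrossed arcs joining NW to SW and NE to SE. - For an integer $n\neq 0$, the tangle $n$ is the horizontal twist (proceeding from west to east) of two strands with $|n|$ crossings. The crossings are right-handed if $n>0$ and left-handed if $n<0$, when both strands are oriented from west to east. Thus in the tangle $1$ the overcrossing strand joins NW to SE, and $\langle 1\rangle=A\langle 0\rangle+A^{-1}\langle\infty\rangle$. - $-T$ denotes the mirror image of $T$ (all crossings switched). - The sum $T+U$ places $U$ to the right of $T$ and joins the NE end of $T$ to the NW end of $U$ and the SE end of $T$ to the SW end of $U$. Write $T-n$ for $T+(-n)$. - The vertical sum $T*U$ places $U$ below $T$ and joins the SE end of $T$ to the NE end of $U$ and the SW end of $T$ to the NW end of $U$. **The omega operation.** For a tangle $T$, define $T^{\omega}=((T+2)*1)+2$. **The diagrams $H(T,U)$.** Take the standard two-crossing diagram of the Hopf link and replace each of its two components by two parallel strands in the plane (the 2-strand parallel, with 8 crossings). On the doubled strands of the first component, away from the crossings, choose a disc meeting the diagram in two parallel arcs and replace its contents by the tangle $T$. Do likewise on the second component with the tangle $U$. The tangles are placed so that inserting the tangle $0$ reproduces the two parallel arcs. The resulting link diagram is $H(T,U)$. In particular, $H(0,0)$ is the 2-strand parallel of the standard Hopf diagram, $H(0,\infty)$ and $H(\infty,0)$ are diagrams of the 3-component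 unlink, and $H(\infty,\infty)$ is a diagram of the 2-component unlink. Their brackets are $\langle H(0,0)\rangle=-(A^{-14}+A^{-6}+2A^{-2}+2A^{2}+A^{6}+A^{14})$, $\langle H(0,\infty)\rangle=\langle H(\infty,0)\rangle=\delta^{2}$, and $\langle H(\infty,\infty)\rangle=\delta$. **The sequence $S(n)$.** Let $T_0=\infty-2$ (that is, $\infty+(-2)$) and $T_{n+1}=(T_n)^{\omega}$ for $n\ge 0$, so that $T_n$ is the result of $n$ applications of $\omega$ to $T_0$; for example $T_1=3$. Define $S(n)=H(T_n,-T_n)$. *)

theory Defs
  imports Complex_Main "HOL-Library.Poly_Mapping" "HOL-Library.Multiset"
begin

text \<open>
  Diagrams are planar diagram codes. An edge is a name; a diagram is a list of pieces whose ends
  carry edge names, and two ends with the same name are connected. In a link diagram every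
  name occurs exactly twice; in a tangle diagram the four boundary names occur once and all others
  twice. \<open>Arc a b\<close> is an uncrossed arc. \<open>Crossing a b c d\<close> lists the four ends of a crossing
  counterclockwise, beginning with an end of the underpass: the underpass joins \<open>a\<close> and \<open>c\<close>, the
  overpass joins \<open>b\<close> and \<open>d\<close>. The constructors \<open>InL\<close> and \<open>InR\<close> keep the names of two diagrams apart
  when they are glued.
\<close>

datatype edge = Edge nat | InL edge | InR edge

datatype piece = Arc edge edge | Crossing edge edge edge edge

type_synonym diagram = "piece list"

fun rename :: "(edge \<Rightarrow> edge) \<Rightarrow> piece \<Rightarrow> piece" where
  "rename f (Arc a b) = Arc (f a) (f b)"
| "rename f (Crossing a b c d) = Crossing (f a) (f b) (f c) (f d)"

text \<open>After switching, \<open>b d\<close> is the underpass, so the list of ends is rotated by one.\<close>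

fun switch :: "piece \<Rightarrow> piece" where
  "switch (Arc a b) = Arc a b"
| "switch (Crossing a b c d) = Crossing b c d a"


subsection \<open>Kauffman bracket\<close>

text \<open>
  The ring \<open>\<int>[A, A\<^sup>-\<^sup>1]\<close> is the type of finitely supported maps from exponents to coefficients,
  with convolution as multiplication.
\<close>

type_synonym laurent = "int \<Rightarrow>\<^sub>0 int"

definition A_pow :: "int \<Rightarrow> laurent" where
  "A_pow k = Poly_Mapping.single k 1"

definition \<delta> :: laurent where
  "\<delta> = - A_pow 2 - A_pow (- 2)"

text \<open>Number of closed curves formed by arcs: connected components of the graph with these edges.
  The subtraction in \<open>resolve\<close> below truncates only for the empty diagram.\<close>

definition loops :: "(edge \<times> edge) list \<Rightarrow> nat" where
  "loops as = card (Field (set as) // (set as \<union> (set as)\<inverse>)\<^sup>*)"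

text \<open>
  The first argument collects the uncrossed arcs. Turning the overpass \<open>b d\<close> counterclockwise sweeps
  the regions between \<open>b, c\<close> and between \<open>d, a\<close>; joining these leaves the arcs \<open>a b\<close> and \<open>c d\<close>.
\<close>

fun resolve :: "(edge \<times> edge) list \<Rightarrow> diagram \<Rightarrow> laurent" where
  "resolve as [] = \<delta> ^ (loops as - 1)"
| "resolve as (Arc a b # D) = resolve ((a, b) # as) D"
| "resolve as (Crossing a b c d # D) =
     A_pow 1 * resolve ((a, b) # (c, d) # as) D
     + A_pow (- 1) * resolve ((a, d) # (b, c) # as) D"

definition bracket :: "diagram \<Rightarrow> laurent" where
  "bracket D = resolve [] D"


subsection \<open>Orientation, writhe and Jones polynomial\<close>

text \<open>
  A direction of a piece is a pair of truth values. For \<open>Arc a b\<close> the first one says whether the arc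
  runs from \<open>a\<close> to \<open>b\<close> (the second is irrelevant). For \<open>Crossing a b c d\<close> the first one says whether
  the underpass runs from \<open>a\<close> to \<open>c\<close>, the second one whether the overpass runs from \<open>b\<close> to \<open>d\<close>.
\<close>

fun sources :: "bool \<times> bool \<Rightarrow> piece \<Rightarrow> edge list" where
  "sources (p, q) (Arc a b) = [if p then a else b]"
| "sources (p, q) (Crossing a b c d) = [if p then a else c, if q then b else d]"

fun targets :: "bool \<times> bool \<Rightarrow> piece \<Rightarrow> edge list" where
  "targets (p, q) (Arc a b) = [if p then b else a]"
| "targets (p, q) (Crossing a b c d) = [if p then c else a, if q then d else b]"

text \<open>Every edge has to be entered at one of its two ends and left at the other.\<close>

definition orientation :: "diagram \<Rightarrow> (bool \<times> bool) list \<Rightarrow> bool" where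
  "orientation D ds \<longleftrightarrow> length ds = length D \<and>
     mset (concat (map2 sources ds D)) = mset (concat (map2 targets ds D))"

text \<open>
  If the overpass runs from \<open>d\<close> to \<open>b\<close>, then \<open>a\<close> is on its right and \<open>c\<close> on its left, so the crossing
  is right-handed if the underpass runs from \<open>a\<close> to \<open>c\<close>.
\<close>

fun crossing_sign :: "bool \<times> bool \<Rightarrow> piece \<Rightarrow> int" where
  "crossing_sign (p, q) (Arc a b) = 0"
| "crossing_sign (p, q) (Crossing a b c d) = (if p \<noteq> q then 1 else - 1)"

definition writhe :: "diagram \<Rightarrow> (bool \<times> bool) list \<Rightarrow> int" where
  "writhe D ds = sum_list (map2 crossing_sign ds D)"

definition neg_A_pow :: "int \<Rightarrow> laurent" where
  "neg_A_pow k = (if 0 \<le> k then (- A_pow 1) ^ nat k else (- A_pow (- 1)) ^ nat (- k))"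

definition normalized_bracket :: "diagram \<Rightarrow> (bool \<times> bool) list \<Rightarrow> laurent" where
  "normalized_bracket D ds = neg_A_pow (- 3 * writhe D ds) * bracket D"

text \<open>Laurent polynomials in roots of \<open>t\<close>, with rational exponents.\<close>

definition t_pow :: "rat \<Rightarrow> (rat \<Rightarrow>\<^sub>0 int)" where
  "t_pow r = Poly_Mapping.single r 1"

definition subst_A :: "laurent \<Rightarrow> (rat \<Rightarrow>\<^sub>0 int)" where
  "subst_A p = (\<Sum>k \<in> Poly_Mapping.keys p.
     of_int (Poly_Mapping.lookup p k) * t_pow (- (of_int k / 4)))"

definition jones :: "diagram \<Rightarrow> (bool \<times> bool) list \<Rightarrow> (rat \<Rightarrow>\<^sub>0 int)" where
  "jones D ds = subst_A (normalized_bracket D ds)"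


subsection \<open>Tangles\<close>

record tangle =
  nw :: edge
  ne :: edge
  sw :: edge
  se :: edge
  pieces :: diagram

definition tangle_zero :: tangle where
  "tangle_zero = \<lparr>nw = Edge 0, ne = Edge 1, sw = Edge 2, se = Edge 3,
     pieces = [Arc (Edge 0) (Edge 1), Arc (Edge 2) (Edge 3)]\<rparr>"

definition tangle_infinity :: tangle where
  "tangle_infinity = \<lparr>nw = Edge 0, ne = Edge 1, sw = Edge 2, se = Edge 3,
     pieces = [Arc (Edge 0) (Edge 2), Arc (Edge 1) (Edge 3)]\<rparr>"

text \<open>A single crossing whose overpass joins NW and SE.\<close>

definition tangle_crossing :: tangle where
  "tangle_crossing = \<lparr>nw = Edge 0, ne = Edge 1, sw = Edge 2, se = Edge 3,
     pieces = [Crossing (Edge 2) (Edge 3) (Edge 1) (Edge 0)]\<rparr>"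

definition tangle_mirror :: "tangle \<Rightarrow> tangle" where
  "tangle_mirror T = T\<lparr>pieces := map switch (pieces T)\<rparr>"

definition tangle_sum :: "tangle \<Rightarrow> tangle \<Rightarrow> tangle" where
  "tangle_sum T U = \<lparr>nw = InL (nw T), ne = InR (ne U), sw = InL (sw T), se = InR (se U),
     pieces = map (rename InL) (pieces T) @ map (rename InR) (pieces U) @
       [Arc (InL (ne T)) (InR (nw U)), Arc (InL (se T)) (InR (sw U))]\<rparr>"

definition tangle_vsum :: "tangle \<Rightarrow> tangle \<Rightarrow> tangle" where
  "tangle_vsum T U = \<lparr>nw = InL (nw T), ne = InL (ne T), sw = InR (sw U), se = InR (se U),
     pieces = map (rename InL) (pieces T) @ map (rename InR) (pieces U) @
       [Arc (InL (se T)) (InR (ne U)), Arc (InL (sw T)) (InR (nw U))]\<rparr>"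

definition tangle_int :: "int \<Rightarrow> tangle" where
  "tangle_int n =
     ((\<lambda>T. tangle_sum T (if 0 < n then tangle_crossing else tangle_mirror tangle_crossing))
        ^^ nat \<bar>n\<bar>) tangle_zero"

definition tangle_omega :: "tangle \<Rightarrow> tangle" where
  "tangle_omega T =
     tangle_sum (tangle_vsum (tangle_sum T (tangle_int 2)) (tangle_int 1)) (tangle_int 2)"


subsection \<open>The diagrams\<close>

text \<open>
  Each tangle is inserted in the arc of its component that lies outside the other component.
  The first component of the Hopf link is drawn as the boundaries of the rectangles
  \<open>[0,7] \<times> [0,7]\<close> and \<open>[1,6] \<times> [1,6]\<close>, the second one as those of \<open>[4,11] \<times> [-3,4]\<close> and
  \<open>[5,10] \<times> [-2,3]\<close>. The tangle \<open>T\<close> sits upright in the top side of the first component, \<open>U\<close> upright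
  in the top side of the second one, to the east of \<open>x = 7\<close>. The crossings, whose ends are listed
  in the order east, north, west, south, are at
  \<open>(7,4), (6,4), (7,3), (6,3)\<close>, where the first component is above, and at
  \<open>(5,1), (4,1), (5,0), (4,0)\<close>, where the second one is.
\<close>

definition hopf_insert :: "tangle \<Rightarrow> tangle \<Rightarrow> diagram" where
  "hopf_insert T U =
     map (rename InL) (pieces T) @ map (rename InR) (pieces U) @
     [Crossing (InR (nw U)) (InL (ne T)) (Edge 6) (Edge 0),
      Crossing (Edge 6) (InL (se T)) (Edge 7) (Edge 3),
      Crossing (InR (sw U)) (Edge 0) (Edge 9) (Edge 1),
      Crossing (Edge 9) (Edge 3) (Edge 10) (Edge 4),
      Crossing (Edge 4) (Edge 10) (Edge 5) (Edge 11),
      Crossing (Edge 5) (Edge 7) (InL (sw T)) (Edge 8),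
      Crossing (Edge 1) (Edge 11) (Edge 2) (InR (se U)),
      Crossing (Edge 2) (Edge 8) (InL (nw T)) (InR (ne U))]"

definition tangle_T :: "nat \<Rightarrow> tangle" where
  "tangle_T n = (tangle_omega ^^ n) (tangle_sum tangle_infinity (tangle_int (- 2)))"

definition S_diagram :: "nat \<Rightarrow> diagram" where
  "S_diagram n = hopf_insert (tangle_T n) (tangle_mirror (tangle_T n))"

end

theory Submission
  imports Defs
begin

text \<open>
  The bracket of a diagram that contains a tangle \<open>T\<close> depends only on the pair \<open>(a, b)\<close> for which
  \<open>\<langle>T\<rangle> = a \<langle>0\<rangle> + b \<langle>\<infinity>\<rangle>\<close> (\<open>has_value\<close>). Therefore \<open>\<langle>H(T, U)\<rangle>\<close> is a bilinear form in the pairs of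
  \<open>T\<close> and \<open>U\<close> (\<open>hopf_form\<close>). If \<open>U\<close> is \<open>\<infinity>\<close>, Reidemeister II moves pull its component away from the
  other one; if \<open>U\<close> is \<open>0\<close>, its component consists of two circles around two parallel strands,
  which are removed one after the other by \<open>meridian\<close>. The operation \<open>\<omega>\<close> acts linearly on pairs,
  and so does its mirror image, by another matrix. These two matrices applied to the two arguments
  leave the form unchanged (\<open>hopf_form_omega\<close>). Hence \<open>\<langle>S(n)\<rangle> = \<langle>S(0)\<rangle> = \<delta>\<close>, the bracket of the
  2-component unlink, and only the writhe distinguishes the Jones polynomials.

  The two strands of a tangle \<open>T\<^sub>n\<close> join NW to SW and NE to SE if \<open>n\<close> is even, and they join
  opposite corners if \<open>n\<close> is odd (\<open>profiles_T\<close>). In both cases the tangle and its doubled strands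
  form one closed curve. For even \<open>n\<close> this curve runs through the two parallel strands in opposite
  directions, so the eight crossings between the components cancel; for odd \<open>n\<close> it runs through
  them in the same direction, and the eight crossings have equal signs, which depend on the
  relative orientation of the components. The crossings inside \<open>T\<^sub>n\<close> and \<open>- T\<^sub>n\<close> cancel, because a
  crossing of a component with itself keeps its sign when the component is reversed and changes it
  in the mirror image. So the writhe is \<open>0\<close> or \<open>\<plusminus> 8\<close> (\<open>writhe_S\<close>), and \<open>(- A)\<^sup>-\<^sup>3\<^sup>w\<close> is \<open>1\<close> or \<open>t\<close>
  to the power \<open>\<plusminus> 6\<close>.

  The calculations become local by two devices. The bracket is used without its normalization, so
  that every circle costs \<open>\<delta>\<close>, and an uncrossed arc may be contracted by identifying the names of
  its ends (\<open>full_bracket_contract\<close>). Orientations are treated as conserved flows, which can be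
  cut along the boundary of a tangle (\<open>profiles\<close>).
\<close>

section \<open>Counting the closed curves\<close>

abbreviation connected :: "(edge \<times> edge) list \<Rightarrow> edge rel" where
  "connected as \<equiv> (set as \<union> (set as)\<inverse>)\<^sup>*"

lemma equiv_connected: "equiv UNIV (connected as)"
proof -
  have "sym (connected as)" by (intro sym_rtrancl sym_Un_converse)
  then show ?thesis by (simp add: equiv_def refl_rtrancl trans_rtrancl)
qed

text \<open>
  The number of values of a function is determined by its kernel, so two functions can be compared
  without a bijection between their images.
\<close>

lemma card_image_eq_if_same_kernel:
  assumes "\<And>x y. x \<in> V \<Longrightarrow> y \<in> V \<Longrightarrow> g x = g y \<longleftrightarrow> h x = h y"
  shows "card (g ` V) = card (h ` V)"
proof -
  define \<phi> where "\<phi> c = h (inv_into V g c)" for c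
  have \<phi>: "\<phi> (g x) = h x" if "x \<in> V" for x
  proof -
    have "inv_into V g (g x) \<in> V" "g (inv_into V g (g x)) = g x"
      using that by (auto intro: inv_into_into f_inv_into_f)
    with assms[OF this(1) that] show ?thesis by (simp add: \<phi>_def)
  qed
  have "inj_on \<phi> (g ` V)"
    unfolding inj_on_def ball_simps using \<phi> assms by metis
  moreover have "\<phi> ` g ` V = h ` V"
    unfolding image_image by (intro image_cong \<phi> refl)
  ultimately show ?thesis by (metis card_image)
qed

lemma card_quotient_eq:
  assumes "equiv UNIV r" "equiv UNIV s" "f ` V = W"
    and "\<And>x y. (x, y) \<in> r \<longleftrightarrow> (f x, f y) \<in> s"
  shows "card (V // r) = card (W // s)"
proof -
  have quotients: "V // r = (\<lambda>x. r `` {x}) ` V" "W // s = (\<lambda>x. s `` {f x}) ` V"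
    using assms(3) by (auto simp: quotient_def)
  have "r `` {x} = r `` {y} \<longleftrightarrow> s `` {f x} = s `` {f y}" for x y
    using eq_equiv_class_iff[OF assms(1)] eq_equiv_class_iff[OF assms(2)] assms(4)[of x y] by blast
  then show ?thesis
    unfolding quotients by (intro card_image_eq_if_same_kernel) blast
qed

lemma loops_cong:
  assumes "set as \<union> (set as)\<inverse> = set bs \<union> (set bs)\<inverse>"
  shows "loops as = loops bs"
proof -
  have "Field (set as \<union> (set as)\<inverse>) = Field (set bs \<union> (set bs)\<inverse>)"
    by (simp only: assms)
  then have "Field (set as) = Field (set bs)" by simp
  then show ?thesis unfolding loops_def assms by simp
qed

text \<open>
  Contracting an edge of a graph does not change its components. The hypothesis excludes the case
  in which the contracted edge is a whole component, whose vertices would disappear.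
\<close>

lemma loops_contract:
  assumes "x \<in> Field (set as) \<or> y \<in> Field (set as)"
  defines "f \<equiv> id(y := x)"
  shows "loops ((x, y) # as) = loops (map (map_prod f f) as)"
  unfolding loops_def
proof (rule card_quotient_eq[where f = f])
  let ?r = "connected ((x, y) # as)" and ?s = "connected (map (map_prod f f) as)"
  show "f ` Field (set ((x, y) # as)) = Field (set (map (map_prod f f) as))"
  proof -
    have "Field (map_prod f f ` r) = f ` Field r" for r
      by (simp add: Field_def Domain_fst Range_snd image_Un image_image)
    moreover have "f ` insert x (insert y V) = f ` V" if "x \<in> V \<or> y \<in> V" for V
      using that by (auto simp: f_def image_iff)
    ultimately show ?thesis using assms(1) by (simp add: insert_commute)
  qed
  have to_f: "(u, f u) \<in> ?r" for u
    by (auto simp: f_def)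
  then have from_f: "(f u, u) \<in> ?r" for u
    using equiv_connected[of "(x, y) # as"] by (meson equivE symD)
  have lift: "(f u, f v) \<in> ?s" if "(u, v) \<in> ?r" for u v
    using that
  proof induction
    case (step v w)
    have "map_prod f f e \<in> set (map (map_prod f f) as)" if "e \<in> set as" for e
      using that by simp
    from this[of "(v, w)"] this[of "(w, v)"] step.hyps(2)
    have "f v = f w \<or> (f v, f w) \<in> set (map (map_prod f f) as) \<union> (set (map (map_prod f f) as))\<inverse>"
      by (auto simp: f_def)
    then have "(f v, f w) \<in> ?s"
      by (metis r_into_rtrancl rtrancl.rtrancl_refl)
    with step.IH show ?case by (rule rtrancl_trans)
  qed simp
  have drop: "(p, q) \<in> ?r" if "(p, q) \<in> ?s" for p q
    using that
  proof induction
    case (step q q')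
    then obtain v w where vw: "q = f v" "q' = f w" "(v, w) \<in> set as \<or> (w, v) \<in> set as"
      by auto
    then have "(v, w) \<in> ?r" by (intro r_into_rtrancl) auto
    from rtrancl_trans[OF from_f rtrancl_trans[OF this to_f]]
    have "(q, q') \<in> ?r" unfolding vw .
    with step.IH show ?case by (rule rtrancl_trans)
  qed simp
  show "(u, v) \<in> ?r \<longleftrightarrow> (f u, f v) \<in> ?s" for u v
    using lift drop[THEN rtrancl_trans[OF to_f rtrancl_trans[OF _ from_f]]] by blast
qed (rule equiv_connected)+

lemma loops_fresh_circle:
  assumes "x \<notin> Field (set as)"
  shows "loops ((x, x) # as) = Suc (loops as)"
proof -
  let ?s = "set as \<union> (set as)\<inverse>"
  have "connected ((x, x) # as) = (?s)\<^sup>*"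
  proof -
    have "set ((x,x)#as) \<union> (set ((x,x)#as))\<inverse> \<subseteq> ?s\<^sup>*"
      by auto
    moreover have "?s \<subseteq> set ((x,x)#as) \<union> (set ((x,x)#as))\<inverse>" by auto
    ultimately show ?thesis by (metis rtrancl_subset)
  qed
  moreover have "Field (set ((x, x) # as)) = insert x (Field (set as))"
    by auto
  moreover have "?s\<^sup>* `` {x} \<notin> Field (set as) // ?s\<^sup>*"
  proof
    assume "?s\<^sup>* `` {x} \<in> Field (set as) // ?s\<^sup>*"
    then obtain v where v: "v \<in> Field (set as)" "?s\<^sup>* `` {x} = ?s\<^sup>* `` {v}"
      by (auto simp: quotient_def)
    then have "(x, v) \<in> ?s\<^sup>*" by auto
    then show False
    proof (cases rule: converse_rtranclE)
      case base
      with v assms show ?thesis by simp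
    next
      case (step y)
      with assms show ?thesis by (auto simp: Field_def)
    qed
  qed
  moreover have "insert x (Field (set as)) // ?s\<^sup>* = insert (?s\<^sup>* `` {x}) (Field (set as) // ?s\<^sup>*)"
    by (auto simp: quotient_def)
  moreover have "finite (Field (set as) // ?s\<^sup>*)"
    by (simp add: quotient_def finite_Field)
  ultimately show ?thesis by (simp add: loops_def)
qed

lemma loops_pos: "as \<noteq> [] \<Longrightarrow> 0 < loops as"
proof -
  assume "as \<noteq> []"
  then have "Field (set as) // connected as \<noteq> {}"
    by (cases as) (auto simp: quotient_def Field_def)
  moreover have "finite (Field (set as) // connected as)"
    by (simp add: quotient_def finite_Field)
  ultimately show ?thesis by (simp add: loops_def card_gt_0_iff)
qed

section \<open>The unreduced bracket\<close>

fun ends :: "piece \<Rightarrow> edge set" where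
  "ends (Arc a b) = {a, b}"
| "ends (Crossing a b c d) = {a, b, c, d}"

definition names :: "diagram \<Rightarrow> edge set" where
  "names D = \<Union> (ends ` set D)"

lemma names_simps [simp]:
  "names [] = {}" "names (p # D) = ends p \<union> names D" "names (D @ E) = names D \<union> names E"
  by (auto simp: names_def)

lemma ends_rename [simp]: "ends (rename f p) = f ` ends p"
  by (cases p) auto

lemma names_rename [simp]: "names (map (rename f) D) = f ` names D"
  by (induction D) auto

lemma rename_id_on: "\<forall>e \<in> ends p. f e = e \<Longrightarrow> rename f p = p"
  by (cases p) auto

lemma map_rename_id_on: "\<forall>e \<in> names D. f e = e \<Longrightarrow> map (rename f) D = D"
  by (induction D) (auto simp: rename_id_on)

lemma rename_rename [simp]: "rename f (rename g p) = rename (f \<circ> g) p"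
  by (cases p) auto

text \<open>
  Unlike \<open>resolve\<close>, this sum gives every circle the factor \<open>\<delta>\<close>, the last one included. A disjoint
  circle then contributes \<open>\<delta>\<close> whatever the rest of the diagram is, and the truncated subtraction
  disappears from all calculations. The price is one factor \<open>\<delta>\<close> overall, which is cancelled at the
  very end.
\<close>

fun state_sum :: "(edge \<times> edge) list \<Rightarrow> diagram \<Rightarrow> laurent" where
  "state_sum as [] = \<delta> ^ loops as"
| "state_sum as (Arc a b # D) = state_sum ((a, b) # as) D"
| "state_sum as (Crossing a b c d # D) =
     A_pow 1 * state_sum ((a, b) # (c, d) # as) D
     + A_pow (- 1) * state_sum ((a, d) # (b, c) # as) D"

definition full_bracket :: "diagram \<Rightarrow> laurent" where
  "full_bracket D = state_sum [] D"

lemma state_sum_resolve: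
  "as \<noteq> [] \<or> D \<noteq> [] \<Longrightarrow> state_sum as D = \<delta> * resolve as D"
proof (induction as D rule: state_sum.induct)
  case (1 as)
  then obtain k where "loops as = Suc k"
    using loops_pos[of as] by (auto simp: gr0_conv_Suc)
  then show ?case by simp
qed (simp_all add: algebra_simps)

lemma full_bracket_bracket: "D \<noteq> [] \<Longrightarrow> full_bracket D = \<delta> * bracket D"
  by (simp add: full_bracket_def bracket_def state_sum_resolve)

lemma state_sum_cong:
  "set as \<union> (set as)\<inverse> = set bs \<union> (set bs)\<inverse> \<Longrightarrow> state_sum as D = state_sum bs D"
proof (induction as D arbitrary: bs rule: state_sum.induct)
  case (1 as)
  then show ?case by (simp add: loops_cong[of as bs])
next
  case (2 as a b D)
  have "set ((a, b) # as) \<union> (set ((a, b) # as))\<inverse> = set ((a, b) # bs) \<union> (set ((a, b) # bs))\<inverse>"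
    using 2(2) by auto
  then show ?case using 2(1) by simp
next
  case (3 as a b c d D)
  have "set ((p, q) # (r, s) # as) \<union> (set ((p, q) # (r, s) # as))\<inverse>
    = set ((p, q) # (r, s) # bs) \<union> (set ((p, q) # (r, s) # bs))\<inverse>" for p q r s
    using 3(3) by auto
  then show ?case using 3(1,2) by (metis state_sum.simps(3))
qed

text \<open>
  A state is an unordered collection of arcs, so the crossings may be resolved in any order.
  Reordering pieces is used throughout to bring crossings that belong together next to each other.
\<close>

lemma state_sum_swap: "state_sum as (p # q # D) = state_sum as (q # p # D)"
proof -
  have same: "state_sum as D = state_sum bs D" if "set as = set bs" for as bs
    by (rule state_sum_cong) (simp add: that)
  have 1: "state_sum as (Arc a b # q # D) = state_sum as (q # Arc a b # D)" for a b q
  proof (cases q)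
    case (Arc c d)
    have "state_sum ((c, d) # (a, b) # as) D = state_sum ((a, b) # (c, d) # as) D"
      by (rule same) auto
    then show ?thesis by (simp add: Arc)
  next
    case (Crossing c d e f)
    have "state_sum (x # y # (a, b) # as) D = state_sum ((a, b) # x # y # as) D" for x y
      by (rule same) auto
    then show ?thesis by (simp add: Crossing)
  qed
  show ?thesis
  proof (cases p)
    case (Arc a b)
    show ?thesis unfolding Arc by (rule 1)
  next
    case p: (Crossing a b c d)
    show ?thesis
    proof (cases q)
      case (Arc e f)
      show ?thesis unfolding Arc by (rule 1[symmetric])
    next
      case q: (Crossing e f g h)
      have "state_sum (x # y # z # w # as) D = state_sum (z # w # x # y # as) D" for x y z w
        by (rule same) auto
      from this[of "(a, b)" "(c, d)"] this[of "(a, d)" "(b, c)"]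
      show ?thesis by (simp add: p q algebra_simps)
    qed
  qed
qed

lemma state_sum_Cons_cong:
  "(\<And>as. state_sum as D = state_sum as E) \<Longrightarrow> state_sum as (p # D) = state_sum as (p # E)"
  by (cases p) simp_all

lemma state_sum_move: "state_sum as (D @ p # E) = state_sum as (p # D @ E)"
proof (induction D arbitrary: as)
  case (Cons q D)
  have "state_sum as (q # D @ p # E) = state_sum as (q # p # D @ E)"
    by (rule state_sum_Cons_cong) (rule Cons)
  then show ?case by (simp add: state_sum_swap)
qed simp

lemma state_sum_perm: "mset D = mset E \<Longrightarrow> state_sum as D = state_sum as E"
proof (induction D arbitrary: as E)
  case (Cons p D)
  then have "p \<in> set E" by (metis list.set_intros(1) set_mset_mset)
  then obtain E1 E2 where E: "E = E1 @ p # E2" by (auto simp: in_set_conv_decomp)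
  with Cons.prems have "mset D = mset (E1 @ E2)" by simp
  then have "state_sum as (p # D) = state_sum as (p # E1 @ E2)"
    by (intro state_sum_Cons_cong Cons.IH)
  then show ?case by (simp add: E state_sum_move)
qed simp

lemma full_bracket_perm: "mset D = mset E \<Longrightarrow> full_bracket D = full_bracket E"
  unfolding full_bracket_def by (rule state_sum_perm)

lemma full_bracket_Nil: "full_bracket [] = 1"
  by (simp add: full_bracket_def loops_def quotient_def)

lemma full_bracket_Crossing:
  "full_bracket (Crossing a b c d # D) =
    A_pow 1 * full_bracket (Arc a b # Arc c d # D) +
    A_pow (- 1) * full_bracket (Arc a d # Arc b c # D)"
proof -
  have swap: "state_sum [p, q] D = state_sum [q, p] D" for p q
    by (rule state_sum_cong) (simp add: insert_commute)
  show ?thesis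
    by (simp add: full_bracket_def swap[of "(a, b)" "(c, d)"] swap[of "(a, d)" "(b, c)"])
qed

lemma full_bracket_Arc_sym: "full_bracket (Arc a b # D) = full_bracket (Arc b a # D)"
proof -
  have "state_sum [(a, b)] D = state_sum [(b, a)] D"
    by (rule state_sum_cong) auto
  then show ?thesis by (simp add: full_bracket_def)
qed

lemma state_sum_contract:
  assumes "x \<in> Field (set as) \<union> names D \<or> y \<in> Field (set as) \<union> names D"
  defines "f \<equiv> id(y := x)"
  shows "state_sum ((x, y) # as) D = state_sum (map (map_prod f f) as) (map (rename f) D)"
  using assms(1)
proof (induction as D rule: state_sum.induct)
  case (1 as)
  then have "loops ((x, y) # as) = loops (map (map_prod f f) as)"
    unfolding f_def by (intro loops_contract) simp
  then show ?case by simp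
next
  case (2 as a b D)
  have "state_sum ((a, b) # (x, y) # as) D = state_sum ((x, y) # (a, b) # as) D"
    by (rule state_sum_cong) auto
  also have "\<dots> = state_sum (map (map_prod f f) ((a, b) # as)) (map (rename f) D)"
    by (rule 2) (use 2(2) in auto)
  finally show ?case by simp
next
  case (3 as a b c d D)
  have move: "state_sum (p # q # (x, y) # as) D = state_sum ((x, y) # p # q # as) D" for p q
    by (rule state_sum_cong) auto
  have "state_sum ((x, y) # (a, b) # (c, d) # as) D
      = state_sum (map (map_prod f f) ((a, b) # (c, d) # as)) (map (rename f) D)"
    by (rule 3(1)) (use 3(3) in auto)
  moreover have "state_sum ((x, y) # (a, d) # (b, c) # as) D
      = state_sum (map (map_prod f f) ((a, d) # (b, c) # as)) (map (rename f) D)"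
    by (rule 3(2)) (use 3(3) in auto)
  ultimately show ?case by (simp add: move)
qed

text \<open>
  An uncrossed arc may be shrunk to a point, identifying the names of its ends. This one rule
  replaces all case distinctions about how an arc continues into the rest of the diagram.
\<close>

lemma full_bracket_contract:
  assumes "x \<in> names D \<or> y \<in> names D"
  shows "full_bracket (Arc x y # D) = full_bracket (map (rename (id(y := x))) D)"
  using state_sum_contract[of x "[]" D y] assms by (simp add: full_bracket_def)

lemma state_sum_fresh_circle:
  "x \<notin> Field (set as) \<union> names D \<Longrightarrow> state_sum ((x, x) # as) D = \<delta> * state_sum as D"
proof (induction as D rule: state_sum.induct)
  case (1 as)
  then show ?case by (simp add: loops_fresh_circle)
next
  case (2 as a b D)
  have "state_sum ((a, b) # (x, x) # as) D = state_sum ((x, x) # (a, b) # as) D"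
    by (rule state_sum_cong) auto
  with 2 show ?case by (simp add: Field_def)
next
  case (3 as a b c d D)
  have move: "state_sum (p # q # (x, x) # as) D = state_sum ((x, x) # p # q # as) D" for p q
    by (rule state_sum_cong) auto
  show ?case using 3 by (simp add: move Field_def algebra_simps)
qed

lemma full_bracket_fresh_circle: "x \<notin> names D \<Longrightarrow> full_bracket (Arc x x # D) = \<delta> * full_bracket D"
  by (simp add: full_bracket_def state_sum_fresh_circle)

section \<open>Evaluating a part of a diagram\<close>

lemma A_pow_mult [simp]: "A_pow j * A_pow k = A_pow (j + k)"
  by (simp add: A_pow_def mult_single)

lemma A_pow_mult_left [simp]: "A_pow j * (A_pow k * x) = A_pow (j + k) * x"
  by (simp flip: mult.assoc)

lemma A_pow_0 [simp]: "A_pow 0 = 1"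
  by (simp add: A_pow_def)

lemma A_pow_power [simp]: "A_pow k ^ n = A_pow (int n * k)"
  by (induction n) (simp_all add: algebra_simps)

lemma A_pow_numeral [simp]:
  "A_pow j * (numeral w * A_pow k) = numeral w * A_pow (j + k)"
  "A_pow j * (numeral w * (A_pow k * x)) = numeral w * (A_pow (j + k) * x)"
  by (metis A_pow_mult mult.left_commute) (metis A_pow_mult_left mult.left_commute)

text \<open>
  A calculus for local computations. The pieces \<open>L\<close> are still to be evaluated, \<open>D\<close> is what
  surrounds them, and the names in \<open>F\<close> are interior, that is, foreign to \<open>D\<close>. Resolving crossings,
  contracting every arc that has an interior end and moving the other arcs to \<open>D\<close> empties \<open>L\<close>; as
  rewrite rules these steps compute the bracket of a part of a diagram in unknown surroundings.
\<close>

definition inside :: "edge set \<Rightarrow> diagram \<Rightarrow> diagram \<Rightarrow> laurent" where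
  "inside F L D = full_bracket (L @ D)"

lemma inside_Nil: "inside F [] D = full_bracket D"
  by (simp add: inside_def)

lemma inside_keep:
  "x \<notin> F \<Longrightarrow> y \<notin> F \<Longrightarrow> inside F (Arc x y # L) D = inside F L (Arc x y # D)"
  unfolding inside_def by (rule full_bracket_perm) simp

lemma inside_contract_right:
  assumes "y \<in> F" "F \<inter> names D = {}" "y \<noteq> x" "y \<in> names L"
  shows "inside F (Arc x y # L) D = inside F (map (rename (id(y := x))) L) D"
proof -
  have "map (rename (id(y := x))) D = D" using assms by (intro map_rename_id_on) auto
  then show ?thesis using full_bracket_contract[of x "L @ D" y] assms by (simp add: inside_def)
qed

lemma inside_contract_left:
  assumes "x \<in> F" "F \<inter> names D = {}" "x \<noteq> y" "x \<in> names L"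
  shows "inside F (Arc x y # L) D = inside F (map (rename (id(x := y))) L) D"
  using inside_contract_right[of x F D y L] assms by (simp add: inside_def full_bracket_Arc_sym)

lemma inside_circle:
  "x \<in> F \<Longrightarrow> F \<inter> names D = {} \<Longrightarrow> x \<notin> names L \<Longrightarrow>
    inside F (Arc x x # L) D = \<delta> * inside F L D"
  by (auto simp: inside_def intro!: full_bracket_fresh_circle)

lemma inside_Crossing:
  "inside F (Crossing a b c d # L) D =
    A_pow 1 * inside F (Arc a b # Arc c d # L) D + A_pow (- 1) * inside F (Arc a d # Arc b c # L) D"
  by (simp add: inside_def full_bracket_Crossing)

lemmas inside_arcs = inside_Nil inside_keep inside_contract_left inside_contract_right inside_circle

lemma full_bracket_swap: "full_bracket (p # q # D) = full_bracket (q # p # D)"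
  by (rule full_bracket_perm) simp

lemma full_bracket_Arc_sym2: "full_bracket (p # Arc a b # D) = full_bracket (p # Arc b a # D)"
  by (metis full_bracket_swap full_bracket_Arc_sym)

text \<open>
  As permutative rewrite rules these bring the arcs of a state into a standard order, so that
  equal states can be collected.
\<close>

lemmas arc_order = full_bracket_Arc_sym full_bracket_Arc_sym2 full_bracket_swap

lemma disjoint_commute: "A \<inter> B = {} \<Longrightarrow> B \<inter> A = {}"
  by auto

text \<open>
  Together with the original hypothesis this provides each inequality of names in both directions,
  as conditional rewriting requires.
\<close>

lemma distinct_reverse: "distinct xs \<Longrightarrow> distinct (rev xs)"
  by simp

text \<open>
  The two crossings bound a bigon with sides \<open>e\<close> (over) and \<open>f\<close> (under). Of the four states one
  has the strands \<open>g g'\<close> and \<open>h e'\<close> pulled apart; the other three coincide up to a circle and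
  cancel because \<open>A\<^sup>2 + \<delta> + A\<^sup>-\<^sup>2 = 0\<close>.
\<close>

lemma reidemeister_2:
  assumes "distinct [e, f]" "{e, f} \<inter> ({g, h, e', g'} \<union> names D) = {}"
  shows "full_bracket (Crossing f e g h # Crossing f e' g' e # D) =
      full_bracket (Arc g g' # Arc h e' # D)"
proof -
  note distinct = assms(1) distinct_reverse[OF assms(1)] assms(2) disjoint_commute[OF assms(2)]
  have "inside {e, f} [Crossing f e g h, Crossing f e' g' e] D =
      full_bracket (Arc g g' # Arc h e' # D)"
    by (simp add: inside_arcs inside_Crossing distinct[simplified])
      (simp add: arc_order \<delta>_def algebra_simps)
  then show ?thesis by (simp add: inside_def)
qed

text \<open>
  A circle around two parallel strands is a linear combination of letting them pass and of making
  them turn back. On strands that turn back already, the circle slides off and contributes \<open>\<delta>\<close>;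
  this forces \<open>\<delta> * meridian_turn = \<delta> - meridian_through\<close>.
\<close>

definition meridian_through :: laurent where
  "meridian_through = - A_pow 6 - A_pow (- 6)"

definition meridian_turn :: laurent where
  "meridian_turn = 2 - A_pow 4 - A_pow (- 4)"

text \<open>
  The circle \<open>y0 y1 y2 y3\<close> passes under the strands \<open>p0 p1 p2\<close> and \<open>q0 q1 q2\<close> on one side and over
  them on the other one. The coefficients come out of the sixteen states.
\<close>

lemma meridian:
  assumes "distinct [y0, y1, y2, y3, p1, q1]"
    "{y0, y1, y2, y3, p1, q1} \<inter> ({p0, q0, p2, q2} \<union> names D) = {}"
  shows "full_bracket ([Crossing y0 p0 y1 p1, Crossing p1 y3 p2 y0,
      Crossing y1 q0 y2 q1, Crossing q1 y2 q2 y3] @ D)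
    = meridian_through * full_bracket (Arc p0 p2 # Arc q0 q2 # D) +
        meridian_turn * full_bracket (Arc p0 q0 # Arc p2 q2 # D)"
proof -
  note distinct = assms(1) distinct_reverse[OF assms(1)] assms(2) disjoint_commute[OF assms(2)]
  have "inside {y0, y1, y2, y3, p1, q1}
      [Crossing y0 p0 y1 p1, Crossing p1 y3 p2 y0, Crossing y1 q0 y2 q1, Crossing q1 y2 q2 y3] D
    = meridian_through * full_bracket (Arc p0 p2 # Arc q0 q2 # D) +
        meridian_turn * full_bracket (Arc p0 q0 # Arc p2 q2 # D)"
    by (simp add: inside_arcs inside_Crossing distinct[simplified])
      (simp add: arc_order meridian_through_def meridian_turn_def \<delta>_def algebra_simps)
  then show ?thesis by (simp add: inside_def)
qed

section \<open>Tangles as linear combinations of the two uncrossed ones\<close>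

definition boundary :: "tangle \<Rightarrow> edge set" where
  "boundary T = {nw T, ne T, sw T, se T}"

definition interior :: "tangle \<Rightarrow> edge set" where
  "interior T = names (pieces T) - boundary T"

definition distinct_boundary :: "tangle \<Rightarrow> bool" where
  "distinct_boundary T \<longleftrightarrow> distinct [nw T, ne T, sw T, se T]"

text \<open>
  The skein module of a disc with four marked points: \<open>has_value T a b\<close> stands for
  \<open>\<langle>T\<rangle> = a \<langle>0\<rangle> + b \<langle>\<infinity>\<rangle>\<close>. The equation is required in all surroundings \<open>D\<close> that do not touch the
  interior of \<open>T\<close>, and for all renamings, since gluing renames a tangle by \<open>InL\<close> or \<open>InR\<close>.
\<close>

definition has_value :: "tangle \<Rightarrow> laurent \<Rightarrow> laurent \<Rightarrow> bool" where
  "has_value T a b \<longleftrightarrow> (\<forall>f D. inj f \<longrightarrow> f ` interior T \<inter> names D = {} \<longrightarrow>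
     full_bracket (map (rename f) (pieces T) @ D) =
       a * full_bracket (Arc (f (nw T)) (f (ne T)) # Arc (f (sw T)) (f (se T)) # D) +
       b * full_bracket (Arc (f (nw T)) (f (sw T)) # Arc (f (ne T)) (f (se T)) # D))"

lemma has_valueD:
  assumes "has_value T a b" "inj f" "f ` interior T \<inter> names D = {}"
    "mset E = mset (map (rename f) (pieces T) @ D)"
  shows "full_bracket E =
       a * full_bracket (Arc (f (nw T)) (f (ne T)) # Arc (f (sw T)) (f (se T)) # D) +
       b * full_bracket (Arc (f (nw T)) (f (sw T)) # Arc (f (ne T)) (f (se T)) # D)"
  using assms full_bracket_perm[OF assms(4)] by (simp add: has_value_def)

lemma has_value_zero: "has_value tangle_zero 1 0"
  by (simp add: has_value_def tangle_zero_def)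

lemma has_value_infinity: "has_value tangle_infinity 0 1"
  by (simp add: has_value_def tangle_infinity_def)

lemma has_value_crossing: "has_value tangle_crossing (A_pow 1) (A_pow (- 1))"
  by (simp add: has_value_def tangle_crossing_def full_bracket_Crossing arc_order)

lemma has_value_mirror_crossing: "has_value (tangle_mirror tangle_crossing) (A_pow (- 1)) (A_pow 1)"
  by (simp add: has_value_def tangle_crossing_def tangle_mirror_def full_bracket_Crossing arc_order)

lemma has_value_mirror_mirror_crossing:
  "has_value (tangle_mirror (tangle_mirror tangle_crossing)) (A_pow 1) (A_pow (- 1))"
  by (simp add: has_value_def tangle_crossing_def tangle_mirror_def full_bracket_Crossing arc_order)

lemma distinct_boundary_sum [simp]:
  "distinct_boundary (tangle_sum T U) \<longleftrightarrow> nw T \<noteq> sw T \<and> ne U \<noteq> se U"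
  by (auto simp: distinct_boundary_def tangle_sum_def)

lemma distinct_boundary_vsum [simp]:
  "distinct_boundary (tangle_vsum T U) \<longleftrightarrow> nw T \<noteq> ne T \<and> sw U \<noteq> se U"
  by (auto simp: distinct_boundary_def tangle_vsum_def)

lemma interior_sum:
  assumes "distinct_boundary T" "distinct_boundary U"
  shows "interior (tangle_sum T U) =
      InL ` (interior T \<union> {ne T, se T}) \<union> InR ` (interior U \<union> {nw U, sw U})"
  using assms
  by (auto simp: interior_def boundary_def tangle_sum_def image_iff distinct_boundary_def)

lemma interior_boundary [simp]:
  "nw T \<notin> interior T" "ne T \<notin> interior T" "sw T \<notin> interior T" "se T \<notin> interior T"
  by (simp_all add: interior_def boundary_def)

text \<open>
  In a sum, \<open>0\<close> is neutral and \<open>\<infinity> + \<infinity>\<close> is \<open>\<infinity>\<close> with an additional circle, whence the term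
  \<open>\<delta> * b * d\<close>.
\<close>

lemma has_value_sum:
  assumes T: "has_value T a b" "distinct_boundary T" and U: "has_value U c d" "distinct_boundary U"
  shows "has_value (tangle_sum T U) (a * c) (a * d + b * c + \<delta> * b * d)"
  unfolding has_value_def
proof (intro allI impI)
  fix f :: "edge \<Rightarrow> edge" and D
  assume f: "inj f" and "f ` interior (tangle_sum T U) \<inter> names D = {}"
  then have fresh: "f ` InL ` (interior T \<union> {ne T, se T}) \<inter> names D = {}"
    "f ` InR ` (interior U \<union> {nw U, sw U}) \<inter> names D = {}"
    by (auto simp: interior_sum[OF T(2) U(2)])
  let ?S = "tangle_sum T U" and ?L = "f \<circ> InL" and ?R = "f \<circ> InR"
  let ?glue = "[Arc (?L (ne T)) (?R (nw U)), Arc (?L (se T)) (?R (sw U))]"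
  have inj: "inj ?L" "inj ?R" using f by (auto simp: inj_def)
  note eqs = inj_eq[OF f]
  have bd: "distinct [nw T, ne T, sw T, se T]" "distinct [nw U, ne U, sw U, se U]"
    using T(2) U(2) by (auto simp: distinct_boundary_def)
  let ?F = "{?L (ne T), ?L (se T), ?R (nw U), ?R (sw U)}"
  note simps = eqs fresh[simplified] bd[simplified]
    distinct_reverse[OF bd(1), simplified] distinct_reverse[OF bd(2), simplified]
  have U_step: "full_bracket (p # q # map (rename ?R) (pieces U) @ ?glue @ D) =
      c * inside ?F (Arc (?R (nw U)) (?R (ne U)) # Arc (?R (sw U)) (?R (se U)) # p # q # ?glue) D +
      d * inside ?F (Arc (?R (nw U)) (?R (sw U)) # Arc (?R (ne U)) (?R (se U)) # p # q # ?glue) D"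
    if "ends p \<union> ends q \<subseteq> range ?L" for p q
  proof -
    have "?R ` interior U \<inter> names (p # q # ?glue @ D) = {}"
      using that fresh by (auto simp: eqs disjoint_iff)
    from has_valueD[OF U(1) inj(2) this] show ?thesis
      unfolding inside_def append_Cons append_Nil by simp
  qed
  have "full_bracket (map (rename f) (pieces (tangle_sum T U)) @ D) =
      a * full_bracket (Arc (?L (nw T)) (?L (ne T)) # Arc (?L (sw T)) (?L (se T)) #
          map (rename ?R) (pieces U) @ ?glue @ D) +
      b * full_bracket (Arc (?L (nw T)) (?L (sw T)) # Arc (?L (ne T)) (?L (se T)) #
          map (rename ?R) (pieces U) @ ?glue @ D)"
  proof (rule has_valueD[OF T(1) inj(1)])
    show "?L ` interior T \<inter> names (map (rename ?R) (pieces U) @ ?glue @ D) = {}"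
      using fresh by (auto simp: eqs disjoint_iff)
  qed (simp add: tangle_sum_def comp_def)
  also have "\<dots> =
      (a * c) * full_bracket (Arc (?L (nw T)) (?R (ne U)) # Arc (?L (sw T)) (?R (se U)) # D) +
      (a * d + b * c + \<delta> * b * d) *
        full_bracket (Arc (?L (nw T)) (?L (sw T)) # Arc (?R (ne U)) (?R (se U)) # D)"
    by (subst U_step, simp, subst U_step, simp, simp add: inside_arcs simps arc_order algebra_simps)
  finally show "full_bracket (map (rename f) (pieces ?S) @ D) =
      a * c * full_bracket (Arc (f (nw ?S)) (f (ne ?S)) # Arc (f (sw ?S)) (f (se ?S)) # D) +
      (a * d + b * c + \<delta> * b * d) *
        full_bracket (Arc (f (nw ?S)) (f (sw ?S)) # Arc (f (ne ?S)) (f (se ?S)) # D)"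
    by (simp add: tangle_sum_def)
qed

text \<open>
  Exchanging the roles of the NE and SW ends turns vertical sums into horizontal ones and
  exchanges \<open>0\<close> and \<open>\<infinity>\<close>. The pieces do not change, so statements about horizontal sums carry over.
\<close>

definition transpose :: "tangle \<Rightarrow> tangle" where
  "transpose T = T\<lparr>ne := sw T, sw := ne T\<rparr>"

lemma transpose_simps [simp]:
  "nw (transpose T) = nw T" "ne (transpose T) = sw T" "sw (transpose T) = ne T"
  "se (transpose T) = se T" "pieces (transpose T) = pieces T"
  by (simp_all add: transpose_def)

lemma boundary_transpose [simp]: "boundary (transpose T) = boundary T"
  by (auto simp: boundary_def)

lemma interior_transpose [simp]: "interior (transpose T) = interior T"
  by (simp add: interior_def)

lemma distinct_boundary_transpose [simp]: "distinct_boundary (transpose T) = distinct_boundary T"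
  by (auto simp: distinct_boundary_def)

lemma has_value_transpose: "has_value (transpose T) b a \<longleftrightarrow> has_value T a b"
  by (simp add: has_value_def add.commute)

lemma vsum_transpose:
  defines "V T U \<equiv> transpose (tangle_sum (transpose T) (transpose U))"
  shows "nw (tangle_vsum T U) = nw (V T U)" "ne (tangle_vsum T U) = ne (V T U)"
    "sw (tangle_vsum T U) = sw (V T U)" "se (tangle_vsum T U) = se (V T U)"
    "mset (pieces (tangle_vsum T U)) = mset (pieces (V T U))"
  by (simp_all add: V_def tangle_sum_def tangle_vsum_def)

lemma has_value_cong:
  assumes "nw T = nw U" "ne T = ne U" "sw T = sw U" "se T = se U"
    and "mset (pieces T) = mset (pieces U)"
  shows "has_value T a b \<longleftrightarrow> has_value U a b"
proof -
  have "set (pieces T) = set (pieces U)" using assms(5) by (rule mset_eq_setD)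
  then have "interior T = interior U"
    using assms by (simp add: interior_def boundary_def names_def)
  moreover have "full_bracket (map (rename f) (pieces T) @ D) =
      full_bracket (map (rename f) (pieces U) @ D)" for f D
    by (rule full_bracket_perm) (simp add: assms(5))
  ultimately show ?thesis using assms by (simp add: has_value_def)
qed

lemma has_value_vsum:
  assumes "has_value T a b" "distinct_boundary T" "has_value U c d" "distinct_boundary U"
  shows "has_value (tangle_vsum T U) (a * d + b * c + \<delta> * a * c) (b * d)"
proof -
  have "has_value (tangle_sum (transpose T) (transpose U)) (b * d) (b * c + a * d + \<delta> * a * c)"
    using assms by (intro has_value_sum) (simp_all add: has_value_transpose)
  then have "has_value (transpose (tangle_sum (transpose T) (transpose U)))
      (b * c + a * d + \<delta> * a * c) (b * d)"
    by (simp only: has_value_transpose)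
  then show ?thesis
    by (simp add: has_value_cong[OF vsum_transpose] add.commute)
qed

section \<open>The bracket of the doubled Hopf link with two tangles\<close>

definition hopf_crossings :: "tangle \<Rightarrow> tangle \<Rightarrow> diagram" where
  "hopf_crossings T U =
     [Crossing (InR (nw U)) (InL (ne T)) (Edge 6) (Edge 0),
      Crossing (Edge 6) (InL (se T)) (Edge 7) (Edge 3),
      Crossing (InR (sw U)) (Edge 0) (Edge 9) (Edge 1),
      Crossing (Edge 9) (Edge 3) (Edge 10) (Edge 4),
      Crossing (Edge 4) (Edge 10) (Edge 5) (Edge 11),
      Crossing (Edge 5) (Edge 7) (InL (sw T)) (Edge 8),
      Crossing (Edge 1) (Edge 11) (Edge 2) (InR (se U)),
      Crossing (Edge 2) (Edge 8) (InL (nw T)) (InR (ne U))]"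

lemma full_bracket_rotate:
  "full_bracket (Crossing a b c d # D) = full_bracket (Crossing c d a b # D)"
  by (simp add: full_bracket_Crossing arc_order)

lemma inside_reidemeister_2:
  assumes "{e, f} \<subseteq> F" "F \<inter> names D = {}" "distinct [e, f]"
    "{e, f} \<inter> ({g, h, e', g'} \<union> names L) = {}"
  shows "inside F (Crossing f e g h # Crossing f e' g' e # L) D =
      inside F (Arc g g' # Arc h e' # L) D"
proof -
  have "{e, f} \<inter> ({g, h, e', g'} \<union> names (L @ D)) = {}"
    using assms by auto
  from reidemeister_2[OF assms(3) this] show ?thesis by (simp add: inside_def)
qed

lemma inside_reidemeister_2_rotated:
  assumes "{e, f} \<subseteq> F" "F \<inter> names D = {}" "distinct [e, f]"
    "{e, f} \<inter> ({g, h, e', g'} \<union> names L) = {}"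
  shows "inside F (Crossing f e g h # Crossing g' e f e' # L) D =
      inside F (Arc g g' # Arc h e' # L) D"
  using inside_reidemeister_2[OF assms] full_bracket_rotate[of g' e f e'] full_bracket_swap
  by (metis append_Cons inside_def)

lemma inside_meridian:
  assumes "{y0, y1, y2, y3, p1, q1} \<subseteq> F" "F \<inter> names D = {}" "distinct [y0, y1, y2, y3, p1, q1]"
    "{y0, y1, y2, y3, p1, q1} \<inter> ({p0, q0, p2, q2} \<union> names L) = {}"
  shows "inside F (Crossing y0 p0 y1 p1 # Crossing p1 y3 p2 y0 #
      Crossing y1 q0 y2 q1 # Crossing q1 y2 q2 y3 # L) D
    = meridian_through * inside F (Arc p0 p2 # Arc q0 q2 # L) D +
        meridian_turn * inside F (Arc p0 q0 # Arc p2 q2 # L) D"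
proof -
  have "{y0, y1, y2, y3, p1, q1} \<inter> ({p0, q0, p2, q2} \<union> names (L @ D)) = {}"
    using assms by auto
  from meridian[OF assms(3) this] show ?thesis by (simp add: inside_def)
qed

abbreviation outside_T :: "edge set" where
  "outside_T \<equiv> range Edge \<union> range InR"

text \<open>
  If \<open>U\<close> is \<open>\<infinity>\<close>, the second component is a single curve that follows its annulus and turns back on
  both sides of \<open>U\<close>. The first component crosses this band four times, each time entirely above or
  entirely below it, so four Reidemeister II moves, starting at a turning point, release the
  curve. What remains is a circle next to the closure of \<open>T\<close>.
\<close>

lemma hopf_infinity:
  assumes D: "names D \<subseteq> range InL" and "distinct_boundary U"
  shows "full_bracket (Arc (InR (nw U)) (InR (sw U)) # Arc (InR (ne U)) (InR (se U)) #
      hopf_crossings T U @ D)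
    = \<delta> * full_bracket (Arc (InL (ne T)) (InL (nw T)) # Arc (InL (se T)) (InL (sw T)) # D)"
proof -
  have fresh: "outside_T \<inter> names D = {}" "Edge k \<notin> names D" "InR x \<notin> names D" "InL x \<notin> range Edge"
    "InL x \<notin> range InR" for k x
    using D by auto
  have bd: "distinct [nw U, ne U, sw U, se U]"
    using assms(2) by (simp add: distinct_boundary_def)
  have "full_bracket (Arc (InR (nw U)) (InR (sw U)) # Arc (InR (ne U)) (InR (se U)) #
      hopf_crossings T U @ D)
    = inside outside_T [Arc (InR (nw U)) (InR (sw U)), Arc (InR (ne U)) (InR (se U)),
      Crossing (InR (sw U)) (Edge 0) (Edge 9) (Edge 1),
      Crossing (InR (nw U)) (InL (ne T)) (Edge 6) (Edge 0),
      Crossing (Edge 9) (Edge 3) (Edge 10) (Edge 4),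
      Crossing (Edge 6) (InL (se T)) (Edge 7) (Edge 3),
      Crossing (Edge 5) (Edge 7) (InL (sw T)) (Edge 8),
      Crossing (Edge 4) (Edge 10) (Edge 5) (Edge 11),
      Crossing (Edge 2) (Edge 8) (InL (nw T)) (InR (ne U)),
      Crossing (Edge 1) (Edge 11) (Edge 2) (InR (se U))] D"
    unfolding inside_def hopf_crossings_def by (rule full_bracket_perm) simp
  also have "\<dots> = \<delta> *
      full_bracket (Arc (InL (ne T)) (InL (nw T)) # Arc (InL (se T)) (InL (sw T)) # D)"
    by (simp add: inside_reidemeister_2 inside_reidemeister_2_rotated inside_arcs fresh
        bd[simplified] distinct_reverse[OF bd, simplified])
      (simp add: arc_order)
  finally show ?thesis .
qed

lemma delta_meridian_turn: "\<delta> * meridian_turn = \<delta> - meridian_through"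
  by (simp add: \<delta>_def meridian_turn_def meridian_through_def algebra_simps)

text \<open>
  \<open>\<delta>\<close> times the bracket of \<open>H(T, U)\<close> for tangles of values \<open>(a, b)\<close> and \<open>(c, d)\<close>. The coefficient
  of \<open>a * c\<close> belongs to the 2-strand parallel of the Hopf link, the other ones to unlinks.
\<close>

definition hopf_form :: "laurent \<Rightarrow> laurent \<Rightarrow> laurent \<Rightarrow> laurent \<Rightarrow> laurent" where
  "hopf_form a b c d =
    a * c * (meridian_through\<^sup>2 * (\<delta>\<^sup>2 - 1) + \<delta>\<^sup>2) + (a * d + b * c) * \<delta>^3 + b * d * \<delta>\<^sup>2"

text \<open>
  If \<open>U\<close> is \<open>0\<close>, the second component consists of two circles around the two parallel strands of
  the first one. The inner circle is removed by the meridian rule. If the strands still pass, the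
  rule applies to the outer circle again; if they turn back, the outer circle slides off by two
  Reidemeister II moves.
\<close>

lemma hopf_zero:
  assumes D: "names D \<subseteq> range InL" and "distinct_boundary U"
  shows "full_bracket (Arc (InR (nw U)) (InR (ne U)) # Arc (InR (sw U)) (InR (se U)) #
      hopf_crossings T U @ D)
    = meridian_through\<^sup>2 *
        full_bracket (Arc (InL (ne T)) (InL (nw T)) # Arc (InL (se T)) (InL (sw T)) # D)
      + meridian_turn * (meridian_through + \<delta>) *
        full_bracket (Arc (InL (ne T)) (InL (se T)) # Arc (InL (nw T)) (InL (sw T)) # D)"
proof -
  have fresh: "outside_T \<inter> names D = {}" "Edge k \<notin> names D" "InR x \<notin> names D" "InL x \<notin> range Edge"
    "InL x \<notin> range InR" for k x
    using D by auto
  have bd: "distinct [nw U, ne U, sw U, se U]"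
    using assms(2) by (simp add: distinct_boundary_def)
  note simps = inside_arcs fresh bd[simplified] distinct_reverse[OF bd, simplified]
  \<comment> \<open>The outer circle with its four crossings, after the strands inside have been rejoined.\<close>
  let ?outer = "\<lambda>x y z w.
     [Crossing (InR (ne U)) (InL (ne T)) (Edge 6) x,
      Crossing y (Edge 8) (InL (nw T)) (InR (ne U)),
      Crossing (Edge 6) (InL (se T)) (Edge 7) z,
      Crossing w (Edge 7) (InL (sw T)) (Edge 8)]"
  have capped: "inside outside_T (?outer (Edge 3) (Edge 5) (Edge 3) (Edge 5)) D
      = \<delta> * full_bracket (Arc (InL (ne T)) (InL (se T)) # Arc (InL (nw T)) (InL (sw T)) # D)"
  proof -
    have "inside outside_T (?outer (Edge 3) (Edge 5) (Edge 3) (Edge 5)) D = inside outside_T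
       [Crossing (Edge 6) (Edge 3) (InR (ne U)) (InL (ne T)),
        Crossing (Edge 6) (InL (se T)) (Edge 7) (Edge 3),
        Crossing (Edge 5) (Edge 8) (InL (nw T)) (InR (ne U)),
        Crossing (Edge 5) (Edge 7) (InL (sw T)) (Edge 8)] D"
      unfolding inside_def append_Cons by (subst full_bracket_rotate, rule full_bracket_perm) simp
    also have "\<dots> = \<delta> *
        full_bracket (Arc (InL (ne T)) (InL (se T)) # Arc (InL (nw T)) (InL (sw T)) # D)"
      by (simp add: inside_reidemeister_2 inside_reidemeister_2_rotated simps)
        (simp add: arc_order)
    finally show ?thesis .
  qed
  have "full_bracket (Arc (InR (nw U)) (InR (ne U)) # Arc (InR (sw U)) (InR (se U)) #
      hopf_crossings T U @ D)
    = inside outside_T ([Arc (InR (nw U)) (InR (ne U)), Arc (InR (sw U)) (InR (se U)),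
      Crossing (InR (sw U)) (Edge 0) (Edge 9) (Edge 1),
      Crossing (Edge 1) (Edge 11) (Edge 2) (InR (se U)),
      Crossing (Edge 9) (Edge 3) (Edge 10) (Edge 4),
      Crossing (Edge 4) (Edge 10) (Edge 5) (Edge 11),
      Crossing (InR (nw U)) (InL (ne T)) (Edge 6) (Edge 0),
      Crossing (Edge 2) (Edge 8) (InL (nw T)) (InR (ne U)),
      Crossing (Edge 6) (InL (se T)) (Edge 7) (Edge 3),
      Crossing (Edge 5) (Edge 7) (InL (sw T)) (Edge 8)]) D"
    unfolding inside_def hopf_crossings_def by (rule full_bracket_perm) simp
  also have "\<dots> = meridian_through\<^sup>2 *
        full_bracket (Arc (InL (ne T)) (InL (nw T)) # Arc (InL (se T)) (InL (sw T)) # D)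
      + meridian_turn * (meridian_through + \<delta>) *
        full_bracket (Arc (InL (ne T)) (InL (se T)) # Arc (InL (nw T)) (InL (sw T)) # D)"
    by (simp add: inside_meridian simps capped)
      (simp add: arc_order algebra_simps power2_eq_square)
  finally show ?thesis .
qed

lemma full_bracket_hopf_insert:
  assumes T: "has_value T a b" "distinct_boundary T" and U: "has_value U c d" "distinct_boundary U"
  shows "full_bracket (hopf_insert T U) = hopf_form a b c d"
proof -
  let ?T = "map (rename InL) (pieces T)"
  have inj: "inj InL" "inj InR" by (auto simp: inj_def)
  have bd: "distinct [nw T, ne T, sw T, se T]"
    using T(2) by (simp add: distinct_boundary_def)
  have unfold: "full_bracket [p, q, r, s] = inside UNIV [p, q, r, s] []" for p q r s
    by (simp add: inside_def)
  have D: "names ?T \<subseteq> range InL" by auto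
  have "InR ` interior U \<inter> names (hopf_crossings T U @ ?T) = {}"
    by (auto simp: hopf_crossings_def)
  from has_valueD[OF U(1) inj(2) this, of "hopf_insert T U"]
  have "full_bracket (hopf_insert T U) =
    c * full_bracket (Arc (InR (nw U)) (InR (ne U)) # Arc (InR (sw U)) (InR (se U)) #
        hopf_crossings T U @ ?T) +
    d * full_bracket (Arc (InR (nw U)) (InR (sw U)) # Arc (InR (ne U)) (InR (se U)) #
        hopf_crossings T U @ ?T)"
    by (simp add: hopf_insert_def hopf_crossings_def)
  also have "\<dots> =
    c * (meridian_through\<^sup>2 *
        full_bracket (Arc (InL (ne T)) (InL (nw T)) # Arc (InL (se T)) (InL (sw T)) # ?T)
      + meridian_turn * (meridian_through + \<delta>) *
        full_bracket (Arc (InL (ne T)) (InL (se T)) # Arc (InL (nw T)) (InL (sw T)) # ?T)) +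
    d * \<delta> * full_bracket (Arc (InL (ne T)) (InL (nw T)) # Arc (InL (se T)) (InL (sw T)) # ?T)"
    using hopf_zero[OF D U(2)] hopf_infinity[OF D U(2)] by simp
  also have "full_bracket (Arc (InL (ne T)) (InL (nw T)) # Arc (InL (se T)) (InL (sw T)) # ?T) =
      a * \<delta>\<^sup>2 + b * \<delta>"
  proof -
    let ?D = "[Arc (InL (ne T)) (InL (nw T)), Arc (InL (se T)) (InL (sw T))]"
    have "InL ` interior T \<inter> names ?D = {}" by auto
    from has_valueD[OF T(1) inj(1) this, of "?D @ ?T"] show ?thesis
      by (simp add: unfold inside_arcs bd[simplified] distinct_reverse[OF bd, simplified]
          full_bracket_Nil power2_eq_square)
  qed
  also have "full_bracket (Arc (InL (ne T)) (InL (se T)) # Arc (InL (nw T)) (InL (sw T)) # ?T) =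
      a * \<delta> + b * \<delta>\<^sup>2"
  proof -
    let ?D = "[Arc (InL (ne T)) (InL (se T)), Arc (InL (nw T)) (InL (sw T))]"
    have "InL ` interior T \<inter> names ?D = {}" by auto
    from has_valueD[OF T(1) inj(1) this, of "?D @ ?T"] show ?thesis
      by (simp add: unfold inside_arcs bd[simplified] distinct_reverse[OF bd, simplified]
          full_bracket_Nil power2_eq_square)
  qed
  also have "c * (meridian_through\<^sup>2 * (a * \<delta>\<^sup>2 + b * \<delta>)
        + meridian_turn * (meridian_through + \<delta>) * (a * \<delta> + b * \<delta>\<^sup>2))
      = c * (meridian_through\<^sup>2 * (a * \<delta>\<^sup>2 + b * \<delta>)
        + (\<delta> * meridian_turn) * (meridian_through + \<delta>) * (a + b * \<delta>))"
    by (simp add: algebra_simps power2_eq_square)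
  finally show ?thesis
    unfolding delta_meridian_turn hopf_form_def
    by (simp add: algebra_simps power2_eq_square power3_eq_cube)
qed

section \<open>Invariance under omega\<close>

lemma has_value_eq: "has_value T a b \<Longrightarrow> a = a' \<Longrightarrow> b = b' \<Longrightarrow> has_value T a' b'"
  by simp

lemma tangle_int_simps:
  "tangle_int 1 = tangle_sum tangle_zero tangle_crossing"
  "tangle_int 2 = tangle_sum (tangle_sum tangle_zero tangle_crossing) tangle_crossing"
  "tangle_int (- 2) = tangle_sum (tangle_sum tangle_zero (tangle_mirror tangle_crossing))
      (tangle_mirror tangle_crossing)"
  by (simp_all add: tangle_int_def numeral_2_eq_2)

lemma tangle_mirror_sum:
  "tangle_mirror (tangle_sum T U) = tangle_sum (tangle_mirror T) (tangle_mirror U)"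
  "tangle_mirror (tangle_vsum T U) = tangle_vsum (tangle_mirror T) (tangle_mirror U)"
proof -
  have "switch (rename f p) = rename f (switch p)" for f p by (cases p) auto
  then show "tangle_mirror (tangle_sum T U) = tangle_sum (tangle_mirror T) (tangle_mirror U)"
    "tangle_mirror (tangle_vsum T U) = tangle_vsum (tangle_mirror T) (tangle_mirror U)"
    by (simp_all add: tangle_mirror_def tangle_sum_def tangle_vsum_def)
qed

lemma tangle_mirror_zero: "tangle_mirror tangle_zero = tangle_zero"
  by (simp add: tangle_mirror_def tangle_zero_def)

lemma tangle_mirror_infinity: "tangle_mirror tangle_infinity = tangle_infinity"
  by (simp add: tangle_mirror_def tangle_infinity_def)

lemma distinct_boundary_basic [simp]:
  "distinct_boundary tangle_zero" "distinct_boundary tangle_infinity"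
  "distinct_boundary tangle_crossing"
  "distinct_boundary (tangle_mirror T) = distinct_boundary T"
  by (simp_all add: distinct_boundary_def tangle_zero_def tangle_infinity_def tangle_crossing_def
      tangle_mirror_def)

text \<open>
  Mirror images of sums are sums of mirror images, but switching a crossing twice gives the list
  of its ends rotated by two. With the crossing as a parameter, \<open>T\<^sub>n\<close> and its mirror image are
  instances of the same construction.
\<close>

definition add_two :: "tangle \<Rightarrow> tangle \<Rightarrow> tangle" where
  "add_two c T = tangle_sum T (tangle_sum (tangle_sum tangle_zero c) c)"

definition omega_with :: "tangle \<Rightarrow> tangle \<Rightarrow> tangle" where
  "omega_with c T = add_two c (tangle_vsum (add_two c T) (tangle_sum tangle_zero c))"

lemma omega_omega_with:
  "tangle_omega T = omega_with tangle_crossing T"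
  "tangle_mirror (tangle_omega T) = omega_with (tangle_mirror tangle_crossing) (tangle_mirror T)"
  by (simp_all add: tangle_omega_def omega_with_def add_two_def tangle_int_simps tangle_mirror_sum
      tangle_mirror_zero)

lemma tangle_T_0:
  "tangle_T 0 = add_two (tangle_mirror tangle_crossing) tangle_infinity"
  "tangle_mirror (tangle_T 0) =
      add_two (tangle_mirror (tangle_mirror tangle_crossing)) tangle_infinity"
  by (simp_all add: tangle_T_def add_two_def tangle_int_simps tangle_mirror_sum tangle_mirror_zero
      tangle_mirror_infinity)

lemma tangle_T_Suc: "tangle_T (Suc n) = tangle_omega (tangle_T n)"
  by (simp add: tangle_T_def)

lemma distinct_boundary_add_two [simp]:
  "distinct_boundary T \<Longrightarrow> distinct_boundary c \<Longrightarrow> distinct_boundary (add_two c T)"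
  by (simp add: add_two_def) (simp add: distinct_boundary_def tangle_sum_def)

lemma distinct_boundary_omega_with [simp]:
  "distinct_boundary T \<Longrightarrow> distinct_boundary c \<Longrightarrow> distinct_boundary (omega_with c T)"
  unfolding omega_with_def
  by (rule distinct_boundary_add_two)
      (auto simp: distinct_boundary_def tangle_sum_def tangle_vsum_def add_two_def)

lemma distinct_boundary_T [simp]: "distinct_boundary (tangle_T n)"
  by (induction n) (simp_all add: tangle_T_0 tangle_T_Suc omega_omega_with)

text \<open>
  Adding a twist to \<open>\<infinity>\<close> is a curl, so \<open>b\<close> is multiplied by \<open>(- A\<^sup>-\<^sup>3\<^sup>e)\<^sup>2\<close>; adding it to \<open>0\<close> gives
  the tangle \<open>2\<close> or \<open>- 2\<close>. The exponent \<open>e\<close> is \<open>1\<close> for the right-handed crossing and \<open>- 1\<close> for the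
  left-handed one.
\<close>

lemma has_value_add_two:
  assumes c: "has_value c (A_pow e) (A_pow (- e))" "distinct_boundary c" and e: "e = 1 \<or> e = -1"
    and T: "has_value T a b" "distinct_boundary T"
  shows "has_value (add_two c T)
    (A_pow (2 * e) * a) ((1 - A_pow (- 4 * e)) * a + A_pow (- 6 * e) * b)"
proof -
  \<comment> \<open>These are the coefficients of \<open>T + ((0 + c) + c)\<close> as the rule for sums produces them.\<close>
  have "has_value (add_two c T)
    (a * (1 * A_pow e * A_pow e))
    (a * (1 * A_pow e * A_pow (- e)
        + (1 * A_pow (- e) + 0 * A_pow e + \<delta> * 0 * A_pow (- e)) * A_pow e
        + \<delta> * (1 * A_pow (- e) + 0 * A_pow e + \<delta> * 0 * A_pow (- e)) * A_pow (- e)) +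
     b * (1 * A_pow e * A_pow e) +
     \<delta> * b * (1 * A_pow e * A_pow (- e)
        + (1 * A_pow (- e) + 0 * A_pow e + \<delta> * 0 * A_pow (- e)) * A_pow e
        + \<delta> * (1 * A_pow (- e) + 0 * A_pow e + \<delta> * 0 * A_pow (- e)) * A_pow (- e)))"
    unfolding add_two_def using c T
    by (intro has_value_sum has_value_zero)
        (auto simp: distinct_boundary_def tangle_sum_def tangle_zero_def)
  then show ?thesis
    by (rule has_value_eq) (use e in \<open>auto simp: \<delta>_def algebra_simps\<close>)
qed

text \<open>
  The two rows of the matrix by which \<open>\<omega>\<close> (for \<open>e = 1\<close>) and its mirror image (for \<open>e = - 1\<close>) act
  on values.
\<close>

definition omega_fst :: "int \<Rightarrow> laurent \<Rightarrow> laurent \<Rightarrow> laurent" where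
  "omega_fst e a b = (A_pow (3 * e) - A_pow (7 * e) - A_pow (- e)) * a + A_pow (- 3 * e) * b"

definition omega_snd :: "int \<Rightarrow> laurent \<Rightarrow> laurent \<Rightarrow> laurent" where
  "omega_snd e a b =
    (2 * A_pow e - A_pow (5 * e) - 2 * A_pow (- 3 * e) + 2 * A_pow (- 7 * e) - A_pow (- 11 * e)) * a
    + (A_pow (- 5 * e) - A_pow (- 9 * e) + A_pow (- 13 * e)) * b"

lemma has_value_omega_with:
  assumes c: "has_value c (A_pow e) (A_pow (- e))" "distinct_boundary c" and e: "e = 1 \<or> e = -1"
    and T: "has_value T a b" "distinct_boundary T"
  shows "has_value (omega_with c T) (omega_fst e a b) (omega_snd e a b)"
proof -
  let ?a1 = "A_pow (2 * e) * a" and ?b1 = "(1 - A_pow (- 4 * e)) * a + A_pow (- 6 * e) * b"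
  let ?a2 = "?a1 * A_pow (- e) + ?b1 * A_pow e + \<delta> * ?a1 * A_pow e"
  have "has_value (tangle_sum tangle_zero c)
      (1 * A_pow e) (1 * A_pow (- e) + 0 * A_pow e + \<delta> * 0 * A_pow (- e))"
    using c by (intro has_value_sum has_value_zero) auto
  then have 1: "has_value (tangle_sum tangle_zero c) (A_pow e) (A_pow (- e))" by simp
  have bd: "distinct_boundary (tangle_sum tangle_zero c)"
    using c(2) by (auto simp: distinct_boundary_def tangle_sum_def tangle_zero_def)
  have "has_value (tangle_vsum (add_two c T) (tangle_sum tangle_zero c)) ?a2 (?b1 * A_pow (- e))"
    using has_value_add_two[OF c e T] c T bd 1 by (intro has_value_vsum) auto
  then have "has_value (omega_with c T) (A_pow (2 * e) * ?a2)
     ((1 - A_pow (- 4 * e)) * ?a2 + A_pow (- 6 * e) * (?b1 * A_pow (- e)))"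
    unfolding omega_with_def
    using c T bd by (intro has_value_add_two e)
        (auto simp: distinct_boundary_def tangle_vsum_def add_two_def tangle_sum_def
        tangle_zero_def)
  then show ?thesis
    by (rule has_value_eq) (use e in \<open>auto simp: omega_fst_def omega_snd_def \<delta>_def algebra_simps\<close>)
qed

text \<open>
  The key identity: replacing \<open>T\<close> by \<open>T\<^sup>\<omega>\<close> and, at the same time, \<open>U\<close> by the result of the
  mirrored operation does not change the bracket of \<open>H(T, U)\<close>. Both sides are bilinear in \<open>(a, b)\<close>
  and \<open>(c, d)\<close>, and the four coefficients agree as Laurent polynomials.
\<close>

lemma hopf_form_omega:
  "hopf_form (omega_fst 1 a b) (omega_snd 1 a b) (omega_fst (- 1) c d) (omega_snd (- 1) c d)
    = hopf_form a b c d"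
  by (simp add: omega_fst_def omega_snd_def hopf_form_def meridian_through_def \<delta>_def
      power2_eq_square power3_eq_cube algebra_simps)

text \<open>
  \<open>\<infinity> - 2\<close> is \<open>\<infinity>\<close> with two curls, whose factors cancel against those of the mirror image; so the
  form starts with \<open>\<delta>\<close> times the bracket \<open>\<delta>\<close> of the 2-component unlink and keeps this value.
\<close>

lemma has_value_T:
  "\<exists>a b c d. has_value (tangle_T n) a b \<and> has_value (tangle_mirror (tangle_T n)) c d \<and>
      hopf_form a b c d = \<delta>\<^sup>2"
proof (induction n)
  case 0
  have "has_value (tangle_T 0) 0 (A_pow 6)"
    using has_value_add_two[of "tangle_mirror tangle_crossing" "-1" tangle_infinity 0 1]
    by (simp add: tangle_T_0 has_value_mirror_crossing has_value_infinity)
  moreover have "has_value (tangle_mirror (tangle_T 0)) 0 (A_pow (- 6))"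
    using has_value_add_two[of "tangle_mirror (tangle_mirror tangle_crossing)" 1
        tangle_infinity 0 1]
    unfolding tangle_T_0(2) by (simp add: has_value_mirror_mirror_crossing has_value_infinity)
  moreover have "hopf_form 0 (A_pow 6) 0 (A_pow (- 6)) = \<delta>\<^sup>2"
    by (simp add: hopf_form_def)
  ultimately show ?case by blast
next
  case (Suc n)
  then obtain a b c d where T: "has_value (tangle_T n) a b"
      "has_value (tangle_mirror (tangle_T n)) c d"
    and form: "hopf_form a b c d = \<delta>\<^sup>2" by blast
  have "has_value (tangle_T (Suc n)) (omega_fst 1 a b) (omega_snd 1 a b)"
    unfolding tangle_T_Suc omega_omega_with(1)
    by (intro has_value_omega_with T) (simp_all add: has_value_crossing)
  moreover have "has_value (tangle_mirror (tangle_T (Suc n)))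
      (omega_fst (- 1) c d) (omega_snd (- 1) c d)"
    unfolding tangle_T_Suc omega_omega_with(2)
    by (intro has_value_omega_with T) (simp_all add: has_value_mirror_crossing)
  ultimately show ?case
    using hopf_form_omega[of a b c d] form by metis
qed

lemma delta_nonzero: "\<delta> \<noteq> 0"
proof
  assume "\<delta> = 0"
  then have "Poly_Mapping.lookup \<delta> 2 = 0" by simp
  then show False by (simp add: \<delta>_def A_pow_def lookup_minus lookup_single)
qed

lemma bracket_S: "bracket (S_diagram n) = \<delta>"
proof -
  obtain a b c d where "has_value (tangle_T n) a b" "has_value (tangle_mirror (tangle_T n)) c d"
    and "hopf_form a b c d = \<delta>\<^sup>2" using has_value_T by blast
  then have "full_bracket (S_diagram n) = \<delta>\<^sup>2"
    by (simp add: S_diagram_def full_bracket_hopf_insert)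
  moreover have "S_diagram n \<noteq> []" by (simp add: S_diagram_def hopf_insert_def)
  ultimately have "\<delta> * bracket (S_diagram n) = \<delta> * \<delta>"
    by (simp add: full_bracket_bracket power2_eq_square)
  with delta_nonzero show ?thesis by simp
qed

section \<open>Orientations as flows\<close>

text \<open>
  An orientation is a flow of strength one that is conserved at every name. This additive form
  makes it possible to orient the parts of a diagram separately: at a boundary point of a tangle
  the flow is \<open>1\<close> if the strand leaves the tangle there and \<open>- 1\<close> if it enters.
\<close>

definition net :: "bool \<times> bool \<Rightarrow> piece \<Rightarrow> edge \<Rightarrow> int" where
  "net d p e = int (count (mset (targets d p)) e) - int (count (mset (sources d p)) e)"

abbreviation sign :: "bool \<Rightarrow> int" where
  "sign x \<equiv> (if x then 1 else - 1)"

lemma net_Arc [simp]: "net (p, q) (Arc a b) e = sign p * (of_bool (e = b) - of_bool (e = a))"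
  by (simp add: net_def)

lemma net_Crossing [simp]:
  "net (p, q) (Crossing a b c d) e =
     sign p * (of_bool (e = c) - of_bool (e = a)) + sign q * (of_bool (e = d) - of_bool (e = b))"
  by (simp add: net_def)

definition flow :: "(bool \<times> bool) list \<Rightarrow> diagram \<Rightarrow> edge \<Rightarrow> int" where
  "flow ds D e = sum_list (map2 (\<lambda>d p. net d p e) ds D)"

lemma flow_simps [simp]:
  "flow [] D e = 0" "flow ds [] e = 0" "flow (d # ds) (p # D) e = net d p e + flow ds D e"
  by (simp_all add: flow_def)

lemma writhe_simps [simp]:
  "writhe [] ds = 0" "writhe D [] = 0" "writhe (p # D) (d # ds) = crossing_sign d p + writhe D ds"
  by (simp_all add: writhe_def)

lemma flow_append [simp]:
  "length ds = length D \<Longrightarrow> flow (ds @ ds') (D @ D') e = flow ds D e + flow ds' D' e"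
  by (simp add: flow_def)

lemma writhe_append [simp]:
  "length ds = length D \<Longrightarrow> writhe (D @ D') (ds @ ds') = writhe D ds + writhe D' ds'"
  by (simp add: writhe_def)

lemma orientation_iff_flow:
  "orientation D ds \<longleftrightarrow> length ds = length D \<and> (\<forall>e. flow ds D e = 0)"
proof -
  have "flow ds D e = int (count (mset (concat (map2 targets ds D))) e)
      - int (count (mset (concat (map2 sources ds D))) e)" for e
  proof (induction ds arbitrary: D)
    case (Cons d ds)
    then show ?case by (cases D) (auto simp: net_def)
  qed simp
  then show ?thesis by (auto simp: orientation_def multiset_eq_iff)
qed

lemma net_rename: "inj f \<Longrightarrow> net d (rename f p) (f e) = net d p e"
  by (cases d; cases p) (auto simp: inj_eq)

lemma net_outside: "e \<notin> ends p \<Longrightarrow> net d p e = 0"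
  by (cases d; cases p) auto

lemma flow_rename: "inj f \<Longrightarrow> flow ds (map (rename f) D) (f e) = flow ds D e"
proof (induction ds arbitrary: D)
  case (Cons d ds)
  then show ?case by (cases D) (auto simp: net_rename)
qed simp

lemma flow_outside: "e \<notin> names D \<Longrightarrow> flow ds D e = 0"
proof (induction ds arbitrary: D)
  case (Cons d ds)
  then show ?case by (cases D) (auto simp: net_outside)
qed simp

lemma flow_other_side:
  "flow ds (map (rename InR) D) (InL e) = 0" "flow ds (map (rename InL) D) (InR e) = 0"
  "flow ds (map (rename InL) D) (Edge k) = 0" "flow ds (map (rename InR) D) (Edge k) = 0"
  by (auto intro!: flow_outside)

lemma writhe_rename: "writhe (map (rename f) D) ds = writhe D ds"
proof (induction ds arbitrary: D)
  case (Cons d ds)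
  have "crossing_sign d (rename f p) = crossing_sign d p" for p by (cases d; cases p) auto
  with Cons show ?case by (cases D) auto
qed simp

type_synonym profile = "int \<times> int \<times> int \<times> int \<times> int"

text \<open>
  All that the rest of a diagram can see of an oriented tangle: the flows at NW, NE, SW, SE, and
  the writhe.
\<close>

definition profiles :: "tangle \<Rightarrow> profile set" where
  "profiles T = {(flow ds (pieces T) (nw T), flow ds (pieces T) (ne T), flow ds (pieces T) (sw T),
      flow ds (pieces T) (se T), writhe (pieces T) ds) | ds.
      length ds = length (pieces T) \<and> (\<forall>e. e \<notin> boundary T \<longrightarrow> flow ds (pieces T) e = 0)}"

lemma profilesI:
  assumes "length ds = length (pieces T)" "\<And>e. e \<notin> boundary T \<Longrightarrow> flow ds (pieces T) e = 0"
    and "flow ds (pieces T) (nw T) = a" "flow ds (pieces T) (ne T) = b"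
    "flow ds (pieces T) (sw T) = c" "flow ds (pieces T) (se T) = d" "writhe (pieces T) ds = w"
  shows "(a, b, c, d, w) \<in> profiles T"
  unfolding profiles_def using assms by blast

text \<open>
  The horizontal sum on the level of profiles. A connecting arc carries one strand, so the flows
  at its two ends must be opposite units.
\<close>

definition glue :: "profile set \<Rightarrow> profile set \<Rightarrow> profile set" where
  "glue P Q = (\<Union>(a, b, c, d, v) \<in> P. \<Union>(a', b', c', d', w) \<in> Q.
     if \<bar>b\<bar> = 1 \<and> \<bar>d\<bar> = 1 \<and> a' = - b \<and> c' = - d then {(a, b', c, d', v + w)} else {})"

lemma glueI:
  assumes "(a, b, c, d, v) \<in> P" "(a', b', c', d', w) \<in> Q"
    and "\<bar>b\<bar> = 1" "\<bar>d\<bar> = 1" "a' = - b" "c' = - d"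
  shows "(a, b', c, d', v + w) \<in> glue P Q"
  unfolding glue_def
  by (rule UN_I[OF assms(1)], unfold split_conv, rule UN_I[OF assms(2)]) (simp add: assms(3-6))

lemma profiles_sum:
  assumes "distinct_boundary T" "distinct_boundary U"
  shows "profiles (tangle_sum T U) = glue (profiles T) (profiles U)"
proof -
  have inj: "inj InL" "inj InR" by (auto simp: inj_def)
  have bd: "distinct [nw T, ne T, sw T, se T]" "distinct [nw U, ne U, sw U, se U]"
    using assms by (auto simp: distinct_boundary_def)
  note bds = bd[simplified]
    distinct_reverse[OF bd(1), simplified] distinct_reverse[OF bd(2), simplified]
  let ?S = "pieces (tangle_sum T U)"
  have flow:
    "flow (ds1 @ ds2 @ [(g1, h1), (g2, h2)]) ?S (InL e) = flow ds1 (pieces T) e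
       + (if g1 then -1 else 1) * of_bool (e = ne T) + (if g2 then -1 else 1) * of_bool (e = se T)"
    "flow (ds1 @ ds2 @ [(g1, h1), (g2, h2)]) ?S (InR e) = flow ds2 (pieces U) e
       + (if g1 then 1 else -1) * of_bool (e = nw U) + (if g2 then 1 else -1) * of_bool (e = sw U)"
    "flow (ds1 @ ds2 @ [(g1, h1), (g2, h2)]) ?S (Edge k) = 0"
    "writhe ?S (ds1 @ ds2 @ [(g1, h1), (g2, h2)]) = writhe (pieces T) ds1 + writhe (pieces U) ds2"
    if "length ds1 = length (pieces T)" "length ds2 = length (pieces U)"
    for ds1 ds2 g1 h1 g2 h2 e k
    using that
    by (simp_all add: tangle_sum_def flow_rename[OF inj(1)] flow_rename[OF inj(2)]
        flow_other_side writhe_rename)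
  show ?thesis
  proof (intro equalityI subsetI)
    fix x assume "x \<in> profiles (tangle_sum T U)"
    then obtain ds where x:
        "x = (flow ds ?S (InL (nw T)), flow ds ?S (InR (ne U)), flow ds ?S (InL (sw T)),
        flow ds ?S (InR (se U)), writhe ?S ds)" and len: "length ds = length ?S"
      and zero: "\<And>e. e \<notin> {InL (nw T), InR (ne U), InL (sw T), InR (se U)} \<Longrightarrow> flow ds ?S e = 0"
      by (auto simp: profiles_def boundary_def tangle_sum_def)
    define ds1 ds2 ds3 where "ds1 = take (length (pieces T)) ds"
      and "ds2 = take (length (pieces U)) (drop (length (pieces T)) ds)"
      and "ds3 = drop (length (pieces U)) (drop (length (pieces T)) ds)"
    have lens: "length ds1 = length (pieces T)" "length ds2 = length (pieces U)"
      and len3: "length ds3 = 2"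
      using len by (simp_all add: ds1_def ds2_def ds3_def tangle_sum_def)
    have ds: "ds = ds1 @ ds2 @ ds3"
      by (simp add: ds1_def ds2_def ds3_def del: drop_drop)
    from len3 obtain g1 h1 g2 h2 where ds3: "ds3 = [(g1, h1), (g2, h2)]"
      by (auto simp: length_Suc_conv numeral_2_eq_2)
    note flow = flow[OF lens, of g1 h1 g2 h2, folded ds3, folded ds]
    have zeroT: "flow ds1 (pieces T) e = 0" if "e \<notin> boundary T" for e
      using zero[of "InL e"] flow(1)[of e] that by (auto simp: boundary_def)
    have zeroU: "flow ds2 (pieces U) e = 0" if "e \<notin> boundary U" for e
      using zero[of "InR e"] flow(2)[of e] that by (auto simp: boundary_def)
    have "(flow ds1 (pieces T) (nw T), flow ds1 (pieces T) (ne T), flow ds1 (pieces T) (sw T),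
      flow ds1 (pieces T) (se T), writhe (pieces T) ds1) \<in> profiles T"
      "(flow ds2 (pieces U) (nw U), flow ds2 (pieces U) (ne U), flow ds2 (pieces U) (sw U),
      flow ds2 (pieces U) (se U), writhe (pieces U) ds2) \<in> profiles U"
      using lens zeroT zeroU by (auto simp: profiles_def)
    moreover have "flow ds1 (pieces T) (ne T) = (if g1 then 1 else -1)"
      "flow ds1 (pieces T) (se T) = (if g2 then 1 else -1)"
      "flow ds2 (pieces U) (nw U) = (if g1 then -1 else 1)"
      "flow ds2 (pieces U) (sw U) = (if g2 then -1 else 1)"
      using zero[of "InL (ne T)"] zero[of "InL (se T)"] zero[of "InR (nw U)"] zero[of "InR (sw U)"]
        flow(1)[of "ne T"] flow(1)[of "se T"] flow(2)[of "nw U"] flow(2)[of "sw U"]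
      by (auto simp: bds split: if_splits)
    ultimately show "x \<in> glue (profiles T) (profiles U)"
      unfolding x flow by (auto simp: bds intro!: glueI)
  next
    fix x assume "x \<in> glue (profiles T) (profiles U)"
    then obtain a b c d v b' d' w where T: "(a, b, c, d, v) \<in> profiles T"
        and U: "(- b, b', - d, d', w) \<in> profiles U"
      and unit: "\<bar>b\<bar> = 1" "\<bar>d\<bar> = 1" and x: "x = (a, b', c, d', v + w)"
      by (auto simp: glue_def split: if_splits)
    from T obtain ds1 where ds1: "a = flow ds1 (pieces T) (nw T)" "b = flow ds1 (pieces T) (ne T)"
      "c = flow ds1 (pieces T) (sw T)" "d = flow ds1 (pieces T) (se T)" "v = writhe (pieces T) ds1"
      "length ds1 = length (pieces T)" "\<And>e. e \<notin> boundary T \<Longrightarrow> flow ds1 (pieces T) e = 0"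
      by (auto simp: profiles_def)
    from U obtain ds2 where ds2: "- b = flow ds2 (pieces U) (nw U)"
      "b' = flow ds2 (pieces U) (ne U)"
      "- d = flow ds2 (pieces U) (sw U)" "d' = flow ds2 (pieces U) (se U)"
      "w = writhe (pieces U) ds2"
      "length ds2 = length (pieces U)" "\<And>e. e \<notin> boundary U \<Longrightarrow> flow ds2 (pieces U) e = 0"
      by (auto simp: profiles_def)
    define ds where "ds = ds1 @ ds2 @ [(b = 1, True), (d = 1, True)]"
    note flow = flow[OF ds1(6) ds2(6), of "b = 1" True "d = 1" True, folded ds_def]
    have boundary_S: "boundary (tangle_sum T U) = {InL (nw T), InR (ne U), InL (sw T), InR (se U)}"
      by (simp add: boundary_def tangle_sum_def)
    have "flow ds ?S e = 0" if "e \<notin> boundary (tangle_sum T U)" for e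
    proof (cases e)
      case (Edge k)
      then show ?thesis by (simp add: flow(3))
    next
      case (InL e')
      then show ?thesis
        using that unit ds1(2,4) ds1(7)[of e'] bds
        by (auto simp: flow(1) boundary_def[of T] boundary_S)
    next
      case (InR e')
      then show ?thesis
        using that unit ds2(1,3) ds2(7)[of e'] bds
        by (auto simp: flow(2) boundary_def[of U] boundary_S)
    qed
    moreover have "length ds = length ?S"
      using ds1(6) ds2(6) by (simp add: ds_def tangle_sum_def)
    ultimately have "(flow ds ?S (nw (tangle_sum T U)), flow ds ?S (ne (tangle_sum T U)),
        flow ds ?S (sw (tangle_sum T U)),
        flow ds ?S (se (tangle_sum T U)), writhe ?S ds) \<in> profiles (tangle_sum T U)"
      unfolding profiles_def by blast
    moreover have "nw (tangle_sum T U) = InL (nw T)" "ne (tangle_sum T U) = InR (ne U)"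
      "sw (tangle_sum T U) = InL (sw T)" "se (tangle_sum T U) = InR (se U)"
      by (simp_all add: tangle_sum_def)
    ultimately show "x \<in> profiles (tangle_sum T U)"
      by (simp add: x flow bds ds1 ds2)
  qed
qed

text \<open>
  Directions are attached to pieces by position; permuting the pieces means permuting the pairs.
\<close>

lemma reorder_zip:
  "mset (map snd zs) = mset D \<Longrightarrow> \<exists>zs'. mset zs' = mset zs \<and> map snd zs' = D"
proof (induction D arbitrary: zs)
  case (Cons p D)
  then have "p \<in> set (map snd zs)" by (simp flip: set_mset_mset del: mset_map set_map)
  then obtain d where d: "(d, p) \<in> set zs" by auto
  then have "mset zs = add_mset (d, p) (mset (remove1 (d, p) zs))" by simp
  then obtain rest where rest: "mset zs = add_mset (d, p) (mset rest)" by (rule that)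
  with Cons.prems have "mset (map snd rest) = mset D" by simp
  with Cons.IH obtain zs' where "mset zs' = mset rest" "map snd zs' = D" by blast
  with rest show ?case by (intro exI[of _ "(d, p) # zs'"]) simp
qed simp

lemma profiles_mono:
  assumes "nw T = nw U" "ne T = ne U" "sw T = sw U" "se T = se U"
    and "mset (pieces T) = mset (pieces U)"
  shows "profiles T \<subseteq> profiles U"
proof
  fix x assume "x \<in> profiles T"
  then obtain ds where x:
      "x = (flow ds (pieces T) (nw T), flow ds (pieces T) (ne T), flow ds (pieces T) (sw T),
      flow ds (pieces T) (se T), writhe (pieces T) ds)" and len: "length ds = length (pieces T)"
    and zero: "\<And>e. e \<notin> boundary T \<Longrightarrow> flow ds (pieces T) e = 0"
    by (auto simp: profiles_def)
  from len assms(5) have "mset (map snd (zip ds (pieces T))) = mset (pieces U)" by simp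
  then obtain zs where zs: "mset zs = mset (zip ds (pieces T))" "map snd zs = pieces U"
    using reorder_zip by blast
  define ds' where "ds' = map fst zs"
  have zip: "zip ds' (pieces U) = zs"
    unfolding ds'_def zs(2)[symmetric] by (rule zip_map_fst_snd)
  have sum: "sum_list (map f zs) = sum_list (map f (zip ds (pieces T)))" for f :: "_ \<Rightarrow> int"
    by (rule arg_cong[OF zs(1), of "\<lambda>M. sum_mset (image_mset f M)", folded mset_map,
        unfolded sum_mset_sum_list])
  have "flow ds' (pieces U) e = flow ds (pieces T) e" for e
    unfolding flow_def zip by (rule sum)
  moreover have "writhe (pieces U) ds' = writhe (pieces T) ds"
    unfolding writhe_def zip by (rule sum)
  moreover have "length ds' = length (pieces U)" using zs(2) by (metis ds'_def length_map)
  moreover have "boundary U = boundary T" using assms(1-4) by (simp add: boundary_def)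
  ultimately show "x \<in> profiles U"
    unfolding x profiles_def using zero assms(1-4) by (intro CollectI exI[of _ ds']) simp
qed

lemma profiles_cong:
  assumes "nw T = nw U" "ne T = ne U" "sw T = sw U" "se T = se U"
    and "mset (pieces T) = mset (pieces U)"
  shows "profiles T = profiles U"
  using profiles_mono[of T U] profiles_mono[of U T] assms by auto

definition flip :: "profile \<Rightarrow> profile" where
  "flip = (\<lambda>(a, b, c, d, w). (a, c, b, d, w))"

lemma profiles_transpose: "profiles (transpose T) = flip ` profiles T"
  by (auto simp: profiles_def flip_def image_iff)

lemma profiles_vsum:
  assumes "distinct_boundary T" "distinct_boundary U"
  shows "profiles (tangle_vsum T U) = flip ` glue (flip ` profiles T) (flip ` profiles U)"
  using assms by (simp add: profiles_cong[OF vsum_transpose] profiles_transpose profiles_sum)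

definition negate_writhe :: "profile \<Rightarrow> profile" where
  "negate_writhe = (\<lambda>(a, b, c, d, w). (a, b, c, d, - w))"

text \<open>
  When a crossing is switched, its strands keep their directions but exchange their roles, and the
  sign of the crossing changes. The overpass \<open>b d\<close> becomes the underpass \<open>b d\<close>, whereas the
  underpass \<open>a c\<close> is now listed as \<open>c a\<close>.
\<close>

lemma flow_switch:
  "length ds = length D \<Longrightarrow> \<exists>ds'. length ds' = length D \<and>
     (\<forall>e. flow ds' (map switch D) e = flow ds D e) \<and> writhe (map switch D) ds' = - writhe D ds"
proof (induction ds D rule: list_induct2)
  case (Cons d ds p D)
  then obtain ds' where ds': "length ds' = length D" "\<And>e. flow ds' (map switch D) e = flow ds D e"
    "writhe (map switch D) ds' = - writhe D ds" by auto
  obtain u v where d: "d = (u, v)" by (cases d)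
  define d' where "d' = (case p of Arc a b \<Rightarrow> d | Crossing a b c e \<Rightarrow> (v, \<not> u))"
  have "net d' (switch p) e = net d p e" "crossing_sign d' (switch p) = - crossing_sign d p" for e
    by (cases p; auto simp: d d'_def)+
  with ds' show ?case by (intro exI[of _ "d' # ds'"]) simp
qed simp

text \<open>
  The inverse translation of directions. It is not an instance of the previous lemma, because
  switching twice rotates the list of ends.
\<close>

lemma flow_unswitch:
  "length ds' = length D \<Longrightarrow> \<exists>ds. length ds = length D \<and>
     (\<forall>e. flow ds D e = flow ds' (map switch D) e) \<and> writhe D ds = - writhe (map switch D) ds'"
proof (induction ds' D rule: list_induct2)
  case (Cons d ds p D)
  then obtain ds' where ds': "length ds' = length D" "\<And>e. flow ds' D e = flow ds (map switch D) e"
    "writhe D ds' = - writhe (map switch D) ds" by auto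
  obtain u v where d: "d = (u, v)" by (cases d)
  define d' where "d' = (case p of Arc a b \<Rightarrow> d | Crossing a b c e \<Rightarrow> (\<not> v, u))"
  have "net d' p e = net d (switch p) e" "crossing_sign d' p = - crossing_sign d (switch p)" for e
    by (cases p; auto simp: d d'_def)+
  with ds' show ?case by (intro exI[of _ "d' # ds'"]) simp
qed simp

lemma profiles_mirror: "profiles (tangle_mirror T) = negate_writhe ` profiles T"
proof (intro equalityI subsetI)
  fix x assume "x \<in> profiles (tangle_mirror T)"
  then obtain ds' where ds': "length ds' = length (pieces T)"
    "\<And>e. e \<notin> boundary T \<Longrightarrow> flow ds' (map switch (pieces T)) e = 0"
    "x = (flow ds' (map switch (pieces T)) (nw T), flow ds' (map switch (pieces T)) (ne T),
      flow ds' (map switch (pieces T)) (sw T), flow ds' (map switch (pieces T)) (se T),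
      writhe (map switch (pieces T)) ds')"
    by (auto simp: profiles_def tangle_mirror_def boundary_def)
  from flow_unswitch[OF ds'(1)] obtain ds where "length ds = length (pieces T)"
    "\<And>e. flow ds (pieces T) e = flow ds' (map switch (pieces T)) e"
    "writhe (pieces T) ds = - writhe (map switch (pieces T)) ds'" by auto
  with ds' show "x \<in> negate_writhe ` profiles T"
    by (intro image_eqI[of _ _ "(flow ds (pieces T) (nw T), flow ds (pieces T) (ne T),
      flow ds (pieces T) (sw T), flow ds (pieces T) (se T), writhe (pieces T) ds)"])
      (auto simp: profiles_def negate_writhe_def intro!: exI[of _ ds])
next
  fix x assume "x \<in> negate_writhe ` profiles T"
  then obtain ds where ds: "length ds = length (pieces T)"
    "\<And>e. e \<notin> boundary T \<Longrightarrow> flow ds (pieces T) e = 0"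
    "x = (flow ds (pieces T) (nw T), flow ds (pieces T) (ne T),
      flow ds (pieces T) (sw T), flow ds (pieces T) (se T), - writhe (pieces T) ds)"
    by (auto simp: profiles_def negate_writhe_def)
  from flow_switch[OF ds(1)] obtain ds' where "length ds' = length (pieces T)"
    "\<And>e. flow ds' (map switch (pieces T)) e = flow ds (pieces T) e"
    "writhe (map switch (pieces T)) ds' = - writhe (pieces T) ds" by auto
  with ds show "x \<in> profiles (tangle_mirror T)"
    by (auto simp: profiles_def tangle_mirror_def boundary_def intro!: exI[of _ ds'])
qed

section \<open>The connection types of the tangles\<close>

text \<open>
  Profiles of a tangle consisting of two strands, listed by connection type: NW is joined to NE,
  to SW or to SE, respectively. Reversing both strands preserves every crossing sign, so only two
  writhes \<open>p\<close> and \<open>q\<close> occur, one for each relative direction of the strands.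
\<close>

definition flat :: "int \<Rightarrow> int \<Rightarrow> profile set" where
  "flat p q = {(1, -1, 1, -1, p), (-1, 1, -1, 1, p), (1, -1, -1, 1, q), (-1, 1, 1, -1, q)}"

definition upright :: "int \<Rightarrow> int \<Rightarrow> profile set" where
  "upright p q = {(1, 1, -1, -1, p), (-1, -1, 1, 1, p), (1, -1, -1, 1, q), (-1, 1, 1, -1, q)}"

definition diagonal :: "int \<Rightarrow> int \<Rightarrow> profile set" where
  "diagonal p q = {(1, 1, -1, -1, p), (-1, -1, 1, 1, p), (1, -1, 1, -1, q), (-1, 1, -1, 1, q)}"

lemma glue_connections:
  "glue (flat p q) (diagonal p' q') = diagonal (q + p') (p + q')"
  "glue (diagonal p q) (diagonal p' q') = flat (q + q') (p + p')"
  "glue (upright p q) (flat p' q') = upright (p + q') (q + q')"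
  "glue (diagonal p q) (flat p' q') = diagonal (p + q') (q + p')"
  by (simp_all add: glue_def flat_def upright_def diagonal_def insert_commute add.commute)

lemma ex_directions:
  "(\<exists>ds. length ds = Suc n \<and> Q ds) \<longleftrightarrow> (\<exists>p q ds. length ds = n \<and> Q ((p, q) # ds))"
  for Q :: "(bool \<times> bool) list \<Rightarrow> bool"
  by (auto simp: length_Suc_conv)

lemma profiles_crossing: "profiles tangle_crossing = diagonal (- 1) 1"
proof -
  have "x \<in> profiles tangle_crossing \<longleftrightarrow> x \<in> diagonal (- 1) 1" for x
    unfolding profiles_def mem_Collect_eq
    by (simp add: conj_commute[of "x = _"] conj_assoc ex_directions
        tangle_crossing_def boundary_def diagonal_def ex_bool_eq) blast
  then show ?thesis by blast
qed

lemma profiles_zero: "profiles tangle_zero = flat 0 0"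
proof -
  have "x \<in> profiles tangle_zero \<longleftrightarrow> x \<in> flat 0 0" for x
    unfolding profiles_def mem_Collect_eq
    by (simp add: conj_commute[of "x = _"] conj_assoc ex_directions
        tangle_zero_def boundary_def flat_def ex_bool_eq) blast
  then show ?thesis by blast
qed

lemma profiles_infinity: "profiles tangle_infinity = upright 0 0"
proof -
  have "x \<in> profiles tangle_infinity \<longleftrightarrow> x \<in> upright 0 0" for x
    unfolding profiles_def mem_Collect_eq
    by (simp add: conj_commute[of "x = _"] conj_assoc ex_directions
        tangle_infinity_def boundary_def upright_def ex_bool_eq) blast
  then show ?thesis by blast
qed

lemma flip_connections:
  "flip ` flat p q = upright p q" "flip ` upright p q = flat p q"
  "flip ` diagonal p q = diagonal q p"
  by (simp_all add: flip_def flat_def upright_def diagonal_def insert_commute)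

lemma negate_connections:
  "negate_writhe ` flat p q = flat (- p) (- q)"
  "negate_writhe ` upright p q = upright (- p) (- q)"
  "negate_writhe ` diagonal p q = diagonal (- p) (- q)"
  by (simp_all add: negate_writhe_def flat_def upright_def diagonal_def)

lemma profiles_add_two:
  assumes "profiles c = diagonal r s" "distinct_boundary c" "distinct_boundary T"
  shows "profiles T = upright p q \<Longrightarrow> \<exists>p' q'. profiles (add_two c T) = upright p' q'"
    and "profiles T = diagonal p q \<Longrightarrow> \<exists>p' q'. profiles (add_two c T) = diagonal p' q'"
proof -
  have bd: "distinct_boundary (tangle_sum tangle_zero c)"
    using assms(2) by (simp add: distinct_boundary_def tangle_sum_def tangle_zero_def)
  then have bd2: "distinct_boundary (tangle_sum (tangle_sum tangle_zero c) c)"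
    using assms(2) by (simp add: distinct_boundary_def tangle_sum_def tangle_zero_def)
  show "profiles T = upright p q \<Longrightarrow> \<exists>p' q'. profiles (add_two c T) = upright p' q'"
    "profiles T = diagonal p q \<Longrightarrow> \<exists>p' q'. profiles (add_two c T) = diagonal p' q'"
    using assms bd bd2 unfolding add_two_def
    by (simp_all add: profiles_sum profiles_zero glue_connections; blast)+
qed

text \<open>
  Horizontal twists by two crossings preserve the types \<open>upright\<close> and \<open>diagonal\<close>, and the single
  vertical crossing in \<open>\<omega>\<close> exchanges them. Only the type enters the writhe of \<open>S(n)\<close>, because the
  writhes of the mirror image are opposite.
\<close>

lemma profiles_T:
  "if even n then \<exists>p q. profiles (tangle_T n) = upright p q
   else \<exists>p q. profiles (tangle_T n) = diagonal p q"
proof (induction n)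
  case 0
  have "profiles (tangle_mirror tangle_crossing) = diagonal 1 (- 1)"
    by (simp add: profiles_mirror profiles_crossing negate_connections)
  from profiles_add_two(1)[OF this _ _ profiles_infinity] show ?case by (simp add: tangle_T_0)
next
  case (Suc n)
  let ?c = tangle_crossing and ?T = "tangle_T n"
  let ?V = "tangle_vsum (add_two ?c ?T) (tangle_sum tangle_zero ?c)"
  have c: "profiles (tangle_sum tangle_zero ?c) = diagonal (- 1) 1"
      "distinct_boundary (tangle_sum tangle_zero ?c)"
    by (simp_all add: profiles_sum profiles_zero profiles_crossing glue_connections)
      (simp add: tangle_zero_def tangle_crossing_def)
  have V: "profiles ?V = flip ` glue (flip ` profiles (add_two ?c ?T)) (diagonal 1 (- 1))"
    using c by (simp add: profiles_vsum flip_connections)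
  have "distinct_boundary (add_two ?c ?T)" by simp
  with c(2) have bd: "distinct_boundary ?V"
    unfolding distinct_boundary_vsum unfolding distinct_boundary_def by simp
  show ?case
  proof (cases "even n")
    case True
    with Suc obtain p q where T: "profiles ?T = upright p q" by auto
    from profiles_add_two(1)[OF profiles_crossing _ _ T] obtain p' q'
        where "profiles (add_two ?c ?T) = upright p' q'" by auto
    with V have "profiles ?V = diagonal (p' - 1) (q' + 1)"
      by (simp add: flip_connections glue_connections)
    from profiles_add_two(2)[OF profiles_crossing _ bd this] True show ?thesis
      by (simp add: tangle_T_Suc omega_omega_with omega_with_def)
  next
    case False
    with Suc obtain p q where T: "profiles ?T = diagonal p q" by auto
    from profiles_add_two(2)[OF profiles_crossing _ _ T] obtain p' q'
        where "profiles (add_two ?c ?T) = diagonal p' q'" by auto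
    with V have "profiles ?V = upright (p' - 1) (q' + 1)"
      by (simp add: flip_connections glue_connections)
    from profiles_add_two(1)[OF profiles_crossing _ bd this] False show ?thesis
      by (simp add: tangle_T_Suc omega_omega_with omega_with_def)
  qed
qed

section \<open>The writhe of the diagrams\<close>

text \<open>
  Directions of the eight crossings between the components: \<open>x\<close> and \<open>y\<close> tell whether the outer and
  the inner strand of the first component run away from the NE and SE end of \<open>T\<close>, and \<open>z\<close> and \<open>v\<close>
  whether those of the second one run away from the NW and SW end of \<open>U\<close>.
\<close>

definition linking_directions :: "bool \<Rightarrow> bool \<Rightarrow> bool \<Rightarrow> bool \<Rightarrow> (bool \<times> bool) list" where
  "linking_directions x y z v = [(z, x), (z, y), (v, x), (v, y), (y, v), (y, z), (x, v), (x, z)]"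

lemma linking_directions:
  "flow (linking_directions x y z v) (hopf_crossings T U) (InL e) =
      sign x * (of_bool (e = nw T) - of_bool (e = ne T)) +
      sign y * (of_bool (e = sw T) - of_bool (e = se T))"
  "flow (linking_directions x y z v) (hopf_crossings T U) (InR e) =
      sign z * (of_bool (e = ne U) - of_bool (e = nw U)) +
      sign v * (of_bool (e = se U) - of_bool (e = sw U))"
  "flow (linking_directions x y z v) (hopf_crossings T U) (Edge k) = 0"
  "writhe (hopf_crossings T U) (linking_directions x y z v) =
      - (2 * (sign x + sign y) * (sign z + sign v))"
  by (simp_all add: linking_directions_def hopf_crossings_def)

lemma linking_directions_unique:
  assumes "length ds = 8" "\<And>k. flow ds (hopf_crossings T U) (Edge k) = 0"
  obtains x y z v where "ds = linking_directions x y z v"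
proof -
  from assms(1) obtain p1 q1 p2 q2 p3 q3 p4 q4 p5 q5 p6 q6 p7 q7 p8 q8 where
    ds: "ds = [(p1, q1), (p2, q2), (p3, q3), (p4, q4), (p5, q5), (p6, q6), (p7, q7), (p8, q8)]"
    by (auto simp: length_Suc_conv eval_nat_numeral)
  note balanced = assms(2)[unfolded ds hopf_crossings_def]
  have e0: "q1 = q3" using balanced[of 0] by (cases q1; cases q3; simp)
  have e1: "q3 = p7" using balanced[of 1] by (cases q3; cases p7; simp)
  have e2: "p7 = p8" using balanced[of 2] by (cases p7; cases p8; simp)
  have e3: "q2 = q4" using balanced[of 3] by (cases q2; cases q4; simp)
  have e4: "q4 = p5" using balanced[of 4] by (cases q4; cases p5; simp)
  have e5: "p5 = p6" using balanced[of 5] by (cases p5; cases p6; simp)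
  have e6: "p1 = p2" using balanced[of 6] by (cases p1; cases p2; simp)
  have e7: "p2 = q6" using balanced[of 7] by (cases p2; cases q6; simp)
  have e8: "q6 = q8" using balanced[of 8] by (cases q6; cases q8; simp)
  have e9: "p3 = p4" using balanced[of 9] by (cases p3; cases p4; simp)
  have e10: "p4 = q5" using balanced[of 10] by (cases p4; cases q5; simp)
  have e11: "q5 = q7" using balanced[of 11] by (cases q5; cases q7; simp)
  show thesis
    by (rule that[of q1 q2 p1 p3])
        (simp add: ds linking_directions_def flip: e0 e1 e2 e3 e4 e5 e6 e7 e8 e9 e10 e11)
qed

text \<open>
  Going once around an annulus, a strand that leaves \<open>T\<close> at NE returns at NW, and one that leaves
  at SE returns at SW; likewise for \<open>U\<close>. Each strand of one component crosses each strand of the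
  other one twice, with the same sign, which yields the product of the total directions.
\<close>

lemma writhe_hopf_insert:
  assumes "distinct_boundary T" "distinct_boundary U"
  shows "(\<exists>ds. orientation (hopf_insert T U) ds \<and> writhe (hopf_insert T U) ds = w) \<longleftrightarrow>
    (\<exists>x y z v wT wU. (- sign x, sign x, - sign y, sign y, wT) \<in> profiles T \<and>
      (sign z, - sign z, sign v, - sign v, wU) \<in> profiles U \<and>
      w = wT + wU - 2 * (sign x + sign y) * (sign z + sign v))"
proof -
  have inj: "inj InL" "inj InR" by (auto simp: inj_def)
  have bd: "distinct [nw T, ne T, sw T, se T]" "distinct [nw U, ne U, sw U, se U]"
    using assms by (auto simp: distinct_boundary_def)
  note bds = bd[simplified]
    distinct_reverse[OF bd(1), simplified] distinct_reverse[OF bd(2), simplified]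
  let ?H = "hopf_insert T U" and ?C = "hopf_crossings T U"
  have H: "?H = map (rename InL) (pieces T) @ map (rename InR) (pieces U) @ ?C"
    by (simp add: hopf_insert_def hopf_crossings_def)
  have flow:
    "flow (ds1 @ ds2 @ ds3) ?H (InL e) = flow ds1 (pieces T) e + flow ds3 ?C (InL e)"
    "flow (ds1 @ ds2 @ ds3) ?H (InR e) = flow ds2 (pieces U) e + flow ds3 ?C (InR e)"
    "flow (ds1 @ ds2 @ ds3) ?H (Edge k) = flow ds3 ?C (Edge k)"
    "writhe ?H (ds1 @ ds2 @ ds3) = writhe (pieces T) ds1 + writhe (pieces U) ds2 + writhe ?C ds3"
    if "length ds1 = length (pieces T)" "length ds2 = length (pieces U)" for ds1 ds2 ds3 e k
    using that
    by (simp_all add: H flow_rename[OF inj(1)] flow_rename[OF inj(2)] flow_other_side writhe_rename)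
  show ?thesis
  proof (intro iffI; elim exE conjE)
    fix ds assume ori: "orientation ?H ds" and w: "writhe ?H ds = w"
    define ds1 ds2 ds3 where "ds1 = take (length (pieces T)) ds"
      and "ds2 = take (length (pieces U)) (drop (length (pieces T)) ds)"
      and "ds3 = drop (length (pieces U)) (drop (length (pieces T)) ds)"
    have lens: "length ds1 = length (pieces T)" "length ds2 = length (pieces U)" "length ds3 = 8"
      using ori by (simp_all add: ds1_def ds2_def ds3_def orientation_iff_flow hopf_insert_def)
    have ds: "ds = ds1 @ ds2 @ ds3"
      by (simp add: ds1_def ds2_def ds3_def del: drop_drop)
    note flow = flow[OF lens(1,2), of ds3, folded ds]
    have zero: "flow ds ?H e = 0" for e using ori by (simp add: orientation_iff_flow)
    have "flow ds3 ?C (Edge k) = 0" for k using zero[of "Edge k"] flow(3)[of k] by simp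
    from linking_directions_unique[OF lens(3) this] obtain q1 q2 p1 p3
      where "ds3 = linking_directions q1 q2 p1 p3" .
    note flow = flow[unfolded this linking_directions]
    have "flow ds1 (pieces T) e = 0" if "e \<notin> boundary T" for e
      using zero[of "InL e"] that by (simp add: flow boundary_def)
    moreover have "flow ds2 (pieces U) e = 0" if "e \<notin> boundary U" for e
      using zero[of "InR e"] that by (simp add: flow boundary_def)
    moreover have "flow ds1 (pieces T) (nw T) = - sign q1" "flow ds1 (pieces T) (ne T) = sign q1"
      "flow ds1 (pieces T) (sw T) = - sign q2" "flow ds1 (pieces T) (se T) = sign q2"
      using zero[of "InL (nw T)"] zero[of "InL (ne T)"] zero[of "InL (sw T)"] zero[of "InL (se T)"]
      unfolding flow by (simp_all add: bds)
    moreover have "flow ds2 (pieces U) (nw U) = sign p1" "flow ds2 (pieces U) (ne U) = - sign p1"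
      "flow ds2 (pieces U) (sw U) = sign p3" "flow ds2 (pieces U) (se U) = - sign p3"
      using zero[of "InR (nw U)"] zero[of "InR (ne U)"] zero[of "InR (sw U)"] zero[of "InR (se U)"]
      unfolding flow by (simp_all add: bds)
    ultimately have "(- sign q1, sign q1, - sign q2, sign q2, writhe (pieces T) ds1) \<in> profiles T"
      "(sign p1, - sign p1, sign p3, - sign p3, writhe (pieces U) ds2) \<in> profiles U"
      using lens by (blast intro: profilesI)+
    moreover have "w = writhe (pieces T) ds1 + writhe (pieces U) ds2
        - 2 * (sign q1 + sign q2) * (sign p1 + sign p3)"
      using w unfolding flow(4) by (simp only: diff_conv_add_uminus)
    ultimately show "\<exists>x y z v wT wU. (- sign x, sign x, - sign y, sign y, wT) \<in> profiles T \<and>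
      (sign z, - sign z, sign v, - sign v, wU) \<in> profiles U \<and>
      w = wT + wU - 2 * (sign x + sign y) * (sign z + sign v)"
      by blast
  next
    fix x y z v wT wU
    assume "(- sign x, sign x, - sign y, sign y, wT) \<in> profiles T"
    then obtain ds1 where ds1: "- sign x = flow ds1 (pieces T) (nw T)"
      "sign x = flow ds1 (pieces T) (ne T)"
      "- sign y = flow ds1 (pieces T) (sw T)" "sign y = flow ds1 (pieces T) (se T)"
      "wT = writhe (pieces T) ds1"
      "length ds1 = length (pieces T)" "\<And>e. e \<notin> boundary T \<Longrightarrow> flow ds1 (pieces T) e = 0"
      by (auto simp: profiles_def)
    assume "(sign z, - sign z, sign v, - sign v, wU) \<in> profiles U"
    then obtain ds2 where ds2: "sign z = flow ds2 (pieces U) (nw U)"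
      "- sign z = flow ds2 (pieces U) (ne U)"
      "sign v = flow ds2 (pieces U) (sw U)" "- sign v = flow ds2 (pieces U) (se U)"
      "wU = writhe (pieces U) ds2"
      "length ds2 = length (pieces U)" "\<And>e. e \<notin> boundary U \<Longrightarrow> flow ds2 (pieces U) e = 0"
      by (auto simp: profiles_def)
    assume w: "w = wT + wU - 2 * (sign x + sign y) * (sign z + sign v)"
    define ds where "ds = ds1 @ ds2 @ linking_directions x y z v"
    note flow = flow[OF ds1(6) ds2(6), of "linking_directions x y z v", folded ds_def,
        unfolded linking_directions]
    have "flow ds ?H e = 0" for e
    proof (cases e)
      case (Edge k)
      then show ?thesis by (simp add: flow(3))
    next
      case (InL e')
      then show ?thesis
        using ds1(7)[of e'] unfolding InL flow
        by (cases "e' \<in> boundary T") (auto simp: boundary_def bds ds1(1-4)[symmetric])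
    next
      case (InR e')
      then show ?thesis
        using ds2(7)[of e'] unfolding InR flow
        by (cases "e' \<in> boundary U") (auto simp: boundary_def bds ds2(1-4)[symmetric])
    qed
    moreover have "length ds = length ?H"
      using ds1(6) ds2(6) by (simp add: ds_def hopf_insert_def linking_directions_def)
    ultimately have "orientation ?H ds" by (simp add: orientation_iff_flow)
    moreover have "writhe ?H ds = w" by (simp add: flow w ds1(5) ds2(5))
    ultimately show "\<exists>ds. orientation ?H ds \<and> writhe ?H ds = w" by blast
  qed
qed

text \<open>
  The annulus forces the strands of an upright tangle to run in opposite directions and those of a
  diagonal one to run in the same direction.
\<close>

lemma annulus_profile:
  "(- sign x, sign x, - sign y, sign y, w) \<in> upright p q \<longleftrightarrow> y = (\<not> x) \<and> w = q"
  "(- sign x, sign x, - sign y, sign y, w) \<in> diagonal p q \<longleftrightarrow> y = x \<and> w = q"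
  by (cases x; cases y; simp add: upright_def diagonal_def)+

lemma annulus_profile_reversed:
  "(sign x, - sign x, sign y, - sign y, w) \<in> upright p q \<longleftrightarrow> y = (\<not> x) \<and> w = q"
  "(sign x, - sign x, sign y, - sign y, w) \<in> diagonal p q \<longleftrightarrow> y = x \<and> w = q"
  by (cases x; cases y; simp add: upright_def diagonal_def)+

text \<open>
  The tangle and its mirror image contribute opposite writhes, which leaves the eight crossings
  between the components. Antiparallel strands make them cancel, parallel strands make them all
  equal.
\<close>

lemma writhe_S:
  fixes n :: nat
  defines "W \<equiv> {writhe (S_diagram n) ds | ds. orientation (S_diagram n) ds}"
  shows "W = (if even n then {0} else {8, -8})"
proof -
  have W: "w \<in> W \<longleftrightarrow> (\<exists>x y z v wT wU.
      (- sign x, sign x, - sign y, sign y, wT) \<in> profiles (tangle_T n) \<and>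
      (sign z, - sign z, sign v, - sign v, wU) \<in> negate_writhe ` profiles (tangle_T n) \<and>
      w = wT + wU - 2 * (sign x + sign y) * (sign z + sign v))" (is "_ \<longleftrightarrow> ?R") for w
  proof -
    have "w \<in> W \<longleftrightarrow> (\<exists>ds. orientation (S_diagram n) ds \<and> writhe (S_diagram n) ds = w)"
      by (auto simp: W_def)
    also have "\<dots> \<longleftrightarrow> ?R"
      unfolding S_diagram_def profiles_mirror[symmetric] by (rule writhe_hopf_insert) simp_all
    finally show ?thesis .
  qed
  show ?thesis
  proof (cases "even n")
    case True
    with profiles_T[of n] obtain p q where P: "profiles (tangle_T n) = upright p q" by auto
    have "w \<in> W \<longleftrightarrow> w = 0" for w
      unfolding W P negate_connections annulus_profile annulus_profile_reversed
      by (simp add: ex_bool_eq)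
    with True show ?thesis by auto
  next
    case False
    with profiles_T[of n] obtain p q where P: "profiles (tangle_T n) = diagonal p q" by auto
    have "w \<in> W \<longleftrightarrow> w = 8 \<or> w = -8" for w
      unfolding W P negate_connections annulus_profile annulus_profile_reversed
      by (auto simp: ex_bool_eq)
    with False show ?thesis by auto
  qed
qed

section \<open>The Jones polynomial\<close>

lemma subst_A_two_terms:
  assumes "i \<noteq> j"
  shows "subst_A (- A_pow i - A_pow j) = - t_pow (- (of_int i / 4)) - t_pow (- (of_int j / 4))"
proof -
  let ?p = "- A_pow i - A_pow j"
  have lookup: "Poly_Mapping.lookup ?p k = (if k = i \<or> k = j then - 1 else 0)" for k
    using assms by (auto simp: A_pow_def lookup_minus lookup_single when_def)
  then have "Poly_Mapping.keys ?p = {i, j}"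
    by (auto simp: in_keys_iff split: if_splits)
  with assms show ?thesis by (simp add: subst_A_def lookup)
qed

lemma neg_A_pow_24: "neg_A_pow (- 24) = A_pow (- 24)" "neg_A_pow 24 = A_pow 24"
  by (simp_all add: neg_A_pow_def power_minus_even)

lemma t_pow_mult: "t_pow r * t_pow s = t_pow (r + s)"
  by (simp add: t_pow_def mult_single)

lemma jones_S:
  assumes "u = - t_pow (- 1 / 2) - t_pow (1 / 2)"
  shows "writhe (S_diagram n) ds = 0 \<Longrightarrow> jones (S_diagram n) ds = u"
    and "writhe (S_diagram n) ds = 8 \<Longrightarrow> jones (S_diagram n) ds = t_pow 6 * u"
    and "writhe (S_diagram n) ds = - 8 \<Longrightarrow> jones (S_diagram n) ds = t_pow (- 6) * u"
proof -
  have shift: "A_pow k * \<delta> = - A_pow (k + 2) - A_pow (k - 2)" for k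
    by (simp add: \<delta>_def algebra_simps)
  have jones: "subst_A (A_pow k * \<delta>) = t_pow (- (of_int k / 4)) * u" for k
    unfolding shift subst_A_two_terms[of "k + 2" "k - 2", simplified]
    by (simp add: assms algebra_simps t_pow_mult add_divide_distrib diff_divide_distrib)
  show "writhe (S_diagram n) ds = 0 \<Longrightarrow> jones (S_diagram n) ds = u"
    using jones[of 0] by (simp add: jones_def normalized_bracket_def bracket_S neg_A_pow_def
        t_pow_def)
  show "writhe (S_diagram n) ds = 8 \<Longrightarrow> jones (S_diagram n) ds = t_pow 6 * u"
    using jones[of "- 24"] by (simp add: jones_def normalized_bracket_def bracket_S neg_A_pow_24)
  show "writhe (S_diagram n) ds = - 8 \<Longrightarrow> jones (S_diagram n) ds = t_pow (- 6) * u"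
    using jones[of 24] by (simp add: jones_def normalized_bracket_def bracket_S neg_A_pow_24)
qed

theorem theorem5p6:
  fixes n :: nat and u :: "rat \<Rightarrow>\<^sub>0 int"
  assumes u: "u = - t_pow (- 1 / 2) - t_pow (1 / 2)"
  shows "(even n \<longrightarrow>
           (\<forall>ds. orientation (S_diagram n) ds \<longrightarrow> jones (S_diagram n) ds = u)) \<and>
         (odd n \<longrightarrow>
           (\<forall>ds. orientation (S_diagram n) ds \<longrightarrow>
              jones (S_diagram n) ds \<in> {t_pow 6 * u, t_pow (- 6) * u}) \<and>
           (\<exists>ds. orientation (S_diagram n) ds \<and> jones (S_diagram n) ds = t_pow 6 * u) \<and>
           (\<exists>ds. orientation (S_diagram n) ds \<and> jones (S_diagram n) ds = t_pow (- 6) * u))"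
proof (intro conjI impI allI)
  fix ds assume "even n" "orientation (S_diagram n) ds"
  then have "writhe (S_diagram n) ds \<in> {0}" using writhe_S[of n] by auto
  then show "jones (S_diagram n) ds = u" using jones_S(1)[OF u] by simp
next
  fix ds assume "odd n" "orientation (S_diagram n) ds"
  then have "writhe (S_diagram n) ds \<in> {8, - 8}" using writhe_S[of n] by auto
  then show "jones (S_diagram n) ds \<in> {t_pow 6 * u, t_pow (- 6) * u}" using jones_S(2,3)[OF u]
      by auto
next
  assume "odd n"
  then have "8 \<in> {writhe (S_diagram n) ds | ds. orientation (S_diagram n) ds}"
      using writhe_S[of n] by simp
  then show "\<exists>ds. orientation (S_diagram n) ds \<and> jones (S_diagram n) ds = t_pow 6 * u"
    using jones_S(2)[OF u] by fastforce
next
  assume "odd n"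
  then have "- 8 \<in> {writhe (S_diagram n) ds | ds. orientation (S_diagram n) ds}"
      using writhe_S[of n] by simp
  then show "\<exists>ds. orientation (S_diagram n) ds \<and> jones (S_diagram n) ds = t_pow (- 6) * u"
    using jones_S(3)[OF u] by fastforce
qed

end
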